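(* Let $k\ge 2$ be a natural number and let $S$ be a non-sparse $k$-automatic subset of $\mathbb{N}$ with $\gcd(S)=1$. Then there exist effectively computable natural numbers $N=N(S)$ and $M=M(S)$ such that every natural number $n\ge M$ can be expressed as a sum of at most $N$ elements from $S$. Moreover, if the minimal DFA accepting $S$ has $m$ states, then $N\le 5k^{16m+3}$ and $M\le 3k^{16m+5}$.
   Context: $\mathbb{N}=\{0,1,2,\ldots\}$. The canonical base-$k$ expansion of $n\in\mathbb{N}$ is the word over $\{0,1,\ldots,k-1\}$ representing $n$ in base $k$ without leading zeros (the empty word for $n=0$). A set $S\subseteq\mathbb{N}$ is $k$-automatic if the language of canonical base-$k$ expansions of its elements is regular, i.e., accepted by a deterministic finite automaton (DFA, with total transition function $\delta:Q\times\Sigma\to Q$). By convention expansions are read by automata starting with the least significant digit, and "the minimal DFA accepting $S$" means the DFA with the fewest states accepting the language of canonical base-$k$ expansions of elements of $S$ read in this direction. Let $\pi_S(x)=\#\{n\le x : n\in S\}$. $S$ is sparse if there is an integer $d\ge 0$ with $\pi_S(x)=O((\log x)^d)$; otherwise $S$ is non-sparse. $\gcd(S)$ is the greatest common divisor of all elements of $S$. A sum of at most $N$ elements of $S$ is a sum $x_1+\cdots+x_i$ with $1\le i\le N$ and $x_1,\ldots,x_i\in S$ (repetitions allowed). "Effectively computable" means computable by an algorithm from $k$ and a DFA for $S$; the bounds assert that $N$ and $M$ with the stated property may be chosen satisfying them. *)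

theory Defs
  imports Complex_Main "HOL-Library.Landau_Symbols" "HOL-Library.Nat_Bijection"
begin

text \<open>
  Words are lists of digits, least significant digit first, so ``no leading zeros'' is a
  condition on the last entry and the value of a word is \<^term>\<open>horner_sum id k w\<close>.
\<close>

definition canonical_word :: "nat \<Rightarrow> nat list \<Rightarrow> bool" where
  "canonical_word k w \<longleftrightarrow> set w \<subseteq> {..<k} \<and> (w \<noteq> [] \<longrightarrow> last w \<noteq> 0)"

definition expansions :: "nat \<Rightarrow> nat set \<Rightarrow> nat list set" where
  "expansions k S = {w. canonical_word k w \<and> horner_sum id k w \<in> S}"

text \<open>
  The alphabet is \<open>{..<k}\<close>, and the states are \<open>{..<nstates A}\<close>, which up to renaming is an
  arbitrary finite set. The transition function is total on states and letters; its values
  elsewhere are irrelevant.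
\<close>

record dfa =
  nstates :: nat
  start :: nat
  delta :: "nat \<Rightarrow> nat \<Rightarrow> nat"
  final :: "nat set"

definition is_dfa :: "nat \<Rightarrow> dfa \<Rightarrow> bool" where
  "is_dfa k A \<longleftrightarrow> start A < nstates A \<and> final A \<subseteq> {..<nstates A} \<and>
     (\<forall>q<nstates A. \<forall>a<k. delta A q a < nstates A)"

definition language :: "nat \<Rightarrow> dfa \<Rightarrow> nat list set" where
  "language k A = {w. set w \<subseteq> {..<k} \<and> foldl (delta A) (start A) w \<in> final A}"

definition dfa_for :: "nat \<Rightarrow> nat set \<Rightarrow> dfa \<Rightarrow> bool" where
  "dfa_for k S A \<longleftrightarrow> is_dfa k A \<and> language k A = expansions k S"

definition minimal_dfa_for :: "nat \<Rightarrow> nat set \<Rightarrow> dfa \<Rightarrow> bool" where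
  "minimal_dfa_for k S A \<longleftrightarrow> dfa_for k S A \<and> (\<forall>B. dfa_for k S B \<longrightarrow> nstates A \<le> nstates B)"

definition automatic :: "nat \<Rightarrow> nat set \<Rightarrow> bool" where
  "automatic k S \<longleftrightarrow> (\<exists>A. dfa_for k S A)"

definition counting :: "nat set \<Rightarrow> real \<Rightarrow> nat" where
  "counting S x = card {n \<in> S. real n \<le> x}"

definition sparse :: "nat set \<Rightarrow> bool" where
  "sparse S \<longleftrightarrow> (\<exists>d::nat. (\<lambda>x. real (counting S x)) \<in> O[at_top](\<lambda>x. ln x ^ d))"

definition sum_of_at_most :: "nat \<Rightarrow> nat set \<Rightarrow> nat \<Rightarrow> bool" where
  "sum_of_at_most N S n \<longleftrightarrow>
     (\<exists>xs. 1 \<le> length xs \<and> length xs \<le> N \<and> set xs \<subseteq> S \<and> sum_list xs = n)"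

text \<open>
  Algorithms are programs for partial recursive functions; \<open>evaluates f xs y\<close> says
  that the program \<open>f\<close> halts on the arguments \<open>xs\<close> with result \<open>y\<close>.
\<close>

datatype recf =
    Zero
  | Succ
  | Proj nat
  | Comp recf "recf list"
  | PrimRec recf recf
  | Mu recf

inductive evaluates :: "recf \<Rightarrow> nat list \<Rightarrow> nat \<Rightarrow> bool" where
  Zero: "evaluates Zero xs 0"
| Succ: "evaluates Succ [x] (Suc x)"
| Proj: "i < length xs \<Longrightarrow> evaluates (Proj i) xs (xs ! i)"
| Comp: "list_all2 (\<lambda>g y. evaluates g xs y) gs ys \<Longrightarrow> evaluates f ys z \<Longrightarrow>
    evaluates (Comp f gs) xs z"
| PrimRec_0: "evaluates f xs y \<Longrightarrow> evaluates (PrimRec f g) (0 # xs) y"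
| PrimRec_Suc: "evaluates (PrimRec f g) (n # xs) y \<Longrightarrow> evaluates g (n # y # xs) z \<Longrightarrow>
    evaluates (PrimRec f g) (Suc n # xs) z"
| Mu: "evaluates f (n # xs) 0 \<Longrightarrow> (\<forall>i<n. \<exists>y. evaluates f (i # xs) (Suc y)) \<Longrightarrow>
    evaluates (Mu f) xs n"

lemma evaluates_deterministic: "evaluates f xs y \<Longrightarrow> evaluates f xs z \<Longrightarrow> y = z"
proof (induction arbitrary: z rule: evaluates.induct)
  case (Comp xs gs ys f z')
  from Comp.prems obtain ys' where
    ys': "list_all2 (\<lambda>g y. evaluates g xs y) gs ys'" "evaluates f ys' z"
    by (cases rule: evaluates.cases) auto
  from Comp.IH(1) ys'(1) have "ys = ys'"
    unfolding list_all2_conv_all_nth by (metis nth_equalityI)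
  with Comp.IH(2) ys'(2) show ?case by blast
next
  case (Mu f n xs)
  from Mu.prems have z: "evaluates f (z # xs) 0" "\<forall>i<z. \<exists>y. evaluates f (i # xs) (Suc y)"
    by (cases rule: evaluates.cases; blast)+
  have "\<not> z < n" using Mu.IH(2) z(1) by (metis nat.distinct(1))
  moreover have "\<not> n < z" using Mu.IH(1) z(2) by (metis nat.distinct(1))
  ultimately show ?case by simp
next
  case (PrimRec_Suc f g n xs y z')
  from PrimRec_Suc.prems obtain y' where
    "evaluates (PrimRec f g) (n # xs) y'" "evaluates g (n # y' # xs) z"
    by (cases rule: evaluates.cases) auto
  with PrimRec_Suc.IH show ?case by blast
qed (erule evaluates.cases; simp)+

text \<open>
  A DFA over \<open>{..<k}\<close> is presented to a program as one number, coding the list formed by its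
  number of states, its initial state, its transition table and its table of final states.
\<close>

definition encode_dfa :: "nat \<Rightarrow> dfa \<Rightarrow> nat" where
  "encode_dfa k A = list_encode
     (nstates A # start A #
      concat (map (\<lambda>q. map (delta A q) [0..<k]) [0..<nstates A]) @
      map (\<lambda>q. of_bool (q \<in> final A)) [0..<nstates A])"

definition computed_by :: "recf \<Rightarrow> nat \<Rightarrow> nat set \<Rightarrow> nat \<Rightarrow> bool" where
  "computed_by f k S N \<longleftrightarrow> (\<forall>A. dfa_for k S A \<longrightarrow> evaluates f [k, encode_dfa k A] N)"

end

theory Submission
  imports Defs "HOL-Library.FuncSet" "HOL-Number_Theory.Cong"
begin

text \<open>
  Let \<open>L\<close> be the language of canonical expansions of \<open>S\<close> and \<open>m\<close> its number of left quotients.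
  If every state had at most one letter on which a run can return to it, there would be only
  polynomially many accepted words of each length; so, \<open>S\<close> being non-sparse, some state has two
  distinct loops \<open>v\<close>, \<open>v'\<close> of equal length \<open>s \<le> 2 m\<close>, and \<open>u {v, v'}\<^sup>* w \<subseteq> L\<close> with short \<open>u\<close>, \<open>w\<close>. With
  \<open>K = k\<^sup>s\<close> this puts into \<open>S\<close> all numbers \<open>B j + D e\<close> where \<open>e\<close> has \<open>j\<close> base-\<open>K\<close> digits, all of them
  \<open>0\<close> or \<open>1\<close>. Sums of \<open>K - 1\<close> such numbers form an arithmetic progression of length \<open>K\<^sup>j\<close> with
  difference \<open>D\<close>; taking more of them fills the gaps between consecutive \<open>B j\<close>. Residues modulo \<open>D\<close> are
  corrected by fewer than \<open>D\<close> elements below \<open>k\<^sup>2\<^sup>m\<close>, which already have greatest common divisor \<open>1\<close>.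
  The number \<open>m\<close> depends only on \<open>S\<close>, is at most the number of states of any automaton for \<open>S\<close>, and can
  be computed from any of them.
\<close>

section \<open>Runs of finite automata\<close>

locale automaton =
  fixes \<Sigma> :: "'a set" and Q :: "'q set" and \<delta> :: "'q \<Rightarrow> 'a \<Rightarrow> 'q"
  assumes finite_states: "finite Q"
    and step: "q \<in> Q \<Longrightarrow> a \<in> \<Sigma> \<Longrightarrow> \<delta> q a \<in> Q"
begin

lemma run_in_states: "q \<in> Q \<Longrightarrow> set w \<subseteq> \<Sigma> \<Longrightarrow> foldl \<delta> q w \<in> Q"
  by (induction w arbitrary: q) (auto simp: step)

text \<open>Pigeonhole: the \<open>length w + 1\<close> prefixes of \<open>w\<close> lead to at most
  \<open>card Q\<close> states, so two of them lead to the same one.\<close>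

lemma pumping:
  assumes "q \<in> Q" "set w \<subseteq> \<Sigma>" "card Q \<le> length w"
  obtains x y z where "w = x @ y @ z" "y \<noteq> []" "foldl \<delta> q (x @ y) = foldl \<delta> q x"
proof -
  let ?f = "\<lambda>i. foldl \<delta> q (take i w)"
  have "?f ` {..length w} \<subseteq> Q"
    by (intro image_subsetI run_in_states assms(1) order.trans[OF set_take_subset assms(2)])
  then have "\<not> inj_on ?f {..length w}"
    using card_inj_on_le[of ?f "{..length w}" Q] finite_states assms(3) by auto
  then obtain i j where ij: "i < j" "j \<le> length w" "?f i = ?f j"
    unfolding inj_on_def by (metis atMost_iff nat_neq_iff)
  have "take j w = take i w @ drop i (take j w)"
    using ij by (metis append_take_drop_id min.absorb1 order_less_imp_le take_take)
  then show ?thesis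
    using ij by (intro that[of "take i w" "drop i (take j w)" "drop j w"])
      (auto simp: append_take_drop_id append.assoc[symmetric] simp del: append.assoc)
qed

text \<open>Deleting a pumpable factor keeps the state that is reached, so repeated deletion brings
  the length below \<open>card Q\<close>.\<close>

lemma short_word:
  assumes "q \<in> Q" "set w \<subseteq> \<Sigma>"
  obtains w' where "set w' \<subseteq> \<Sigma>" "length w' < card Q" "foldl \<delta> q w' = foldl \<delta> q w"
proof -
  have "\<exists>w'. set w' \<subseteq> \<Sigma> \<and> length w' < card Q \<and> foldl \<delta> q w' = foldl \<delta> q w"
    using assms(2)
  proof (induction w rule: length_induct)
    case (1 w)
    show ?case
    proof (cases "length w < card Q")
      case False
      then obtain x y z where w: "w = x @ y @ z" "y \<noteq> []" "foldl \<delta> q (x @ y) = foldl \<delta> q x"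
        using pumping[OF assms(1) "1.prems"] by (metis not_less)
      then show ?thesis using "1.IH"[rule_format, of "x @ z"] "1.prems" by auto
    qed (use 1 in blast)
  qed
  then show ?thesis using that by blast
qed

text \<open>
  If the letter on which a run can return to its current state is unique, the run is determined
  by the time and the letter of its last exit from every state it visits.
\<close>

lemma card_accepted_words_le:
  assumes "finite \<Sigma>" "q\<^sub>0 \<in> Q"
    and unique: "\<And>u a y b z w. set (u @ a # y @ b # z @ w) \<subseteq> \<Sigma> \<Longrightarrow>
      foldl \<delta> q\<^sub>0 (u @ a # y) = foldl \<delta> q\<^sub>0 u \<Longrightarrow> foldl \<delta> q\<^sub>0 (u @ b # z) = foldl \<delta> q\<^sub>0 u \<Longrightarrow>
      foldl \<delta> q\<^sub>0 (u @ w) \<in> F \<Longrightarrow> a = b"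
  shows "card {w. set w \<subseteq> \<Sigma> \<and> length w = l \<and> foldl \<delta> q\<^sub>0 w \<in> F} \<le> (l * card \<Sigma> + 1) ^ card Q"
proof -
  define visits where "visits w q = {i. i < l \<and> foldl \<delta> q\<^sub>0 (take i w) = q}" for w q
  \<comment> \<open>For each state: the time of its last visit and the letter read then, or
    \<open>None\<close> if it is not visited before time \<open>l\<close>. This leaves
    \<open>l * card \<Sigma> + 1\<close> possible values per state.\<close>
  define exits where "exits w = (\<lambda>q\<in>Q. if visits w q = {} then None
    else Some (Max (visits w q), w ! Max (visits w q)))" for w
  let ?W = "{w. set w \<subseteq> \<Sigma> \<and> length w = l \<and> foldl \<delta> q\<^sub>0 w \<in> F}"
  let ?E = "insert None (Some ` ({..<l} \<times> \<Sigma>))"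
  have fin: "finite (visits w q)" for w q unfolding visits_def by simp
  have Max_visits: "Max (visits w q) \<in> visits w q" if "visits w q \<noteq> {}" for w q
    using Max_in[OF fin that] .
  have "exits ` ?W \<subseteq> Q \<rightarrow>\<^sub>E ?E"
  proof (rule image_subsetI)
    fix w assume w: "w \<in> ?W"
    have "Max (visits w q) < l \<and> w ! Max (visits w q) \<in> \<Sigma>" if "visits w q \<noteq> {}" for q
    proof -
      have "Max (visits w q) < l" using Max_visits[OF that] unfolding visits_def by blast
      then show ?thesis using w by auto
    qed
    then show "exits w \<in> Q \<rightarrow>\<^sub>E ?E" unfolding exits_def by auto
  qed
  moreover have "inj_on exits ?W"
  proof (intro inj_onI)
    fix w w' assume w: "w \<in> ?W" and w': "w' \<in> ?W" and eq: "exits w = exits w'"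
    \<comment> \<open>A later visit to the same state shows that the letter read at time
      \<open>i\<close> begins a loop.\<close>
    have return: "foldl \<delta> q\<^sub>0 (take i v @ v ! i # drop (Suc i) (take j v)) = foldl \<delta> q\<^sub>0 (take i v)"
      if "length v = l" "i < j" "j \<in> visits v (foldl \<delta> q\<^sub>0 (take i v))" for v i j
    proof -
      have "j < l" "foldl \<delta> q\<^sub>0 (take j v) = foldl \<delta> q\<^sub>0 (take i v)"
        using that(3) unfolding visits_def by auto
      moreover have "take j v = take i v @ v ! i # drop (Suc i) (take j v)"
        using that(1,2) \<open>j < l\<close> id_take_nth_drop[of i "take j v"] by (simp add: min_def)
      ultimately show ?thesis by simp
    qed
    have prefix: "take i w = take i w'" if "i \<le> l" for i
      using that
    proof (induction i)
      case (Suc i)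
      then have IH: "take i w = take i w'" and i: "i < l" by auto
      define q where "q = foldl \<delta> q\<^sub>0 (take i w)"
      have q': "q = foldl \<delta> q\<^sub>0 (take i w')" unfolding q_def IH ..
      have "q \<in> Q" unfolding q_def
        using w set_take_subset[of i w] by (intro run_in_states assms(2)) auto
      have vis: "i \<in> visits w q" "i \<in> visits w' q"
        using i q' unfolding visits_def q_def by auto
      have "exits w q = exits w' q" using eq by simp
      then have Max_eq: "Max (visits w q) = Max (visits w' q)"
        and letter_eq: "w ! Max (visits w q) = w' ! Max (visits w' q)"
        using \<open>q \<in> Q\<close> vis unfolding exits_def by (auto split: if_splits)
      \<comment> \<open>At the last visit to \<open>q\<close> the letter is recorded in
        \<open>exits\<close>. Otherwise both words revisit \<open>q\<close> at the common time
        \<open>j\<close>, so both letters begin loops at \<open>q\<close>, and \<open>unique\<close>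
        applies because \<open>w\<close> continues from \<open>q\<close> to acceptance.\<close>
      have "w ! i = w' ! i"
      proof (cases "Max (visits w q) = i")
        case True
        then show ?thesis using Max_eq letter_eq by simp
      next
        case False
        define j where "j = Max (visits w q)"
        have "i < j" using Max_ge[OF fin vis(1)] False unfolding j_def by linarith
        have j: "j \<in> visits w q" "j \<in> visits w' q"
          using Max_visits vis Max_eq unfolding j_def by (metis empty_iff)+
        have "set (take i w @ w ! i # drop (Suc i) (take j w) @
            w' ! i # drop (Suc i) (take j w') @ drop i w) \<subseteq> \<Sigma>"
          using w w' i nth_mem[of i w] nth_mem[of i w'] set_take_subset[of _ w] set_take_subset[of _ w']
            set_drop_subset[of _ w] set_drop_subset[of _ "take j w"] set_drop_subset[of _ "take j w'"]
          by (simp only: mem_Collect_eq set_append set_simps) blast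
        moreover have "foldl \<delta> q\<^sub>0 (take i w @ w ! i # drop (Suc i) (take j w)) = foldl \<delta> q\<^sub>0 (take i w)"
          using return[of w i j] w \<open>i < j\<close> j(1) q_def by blast
        moreover have "foldl \<delta> q\<^sub>0 (take i w @ w' ! i # drop (Suc i) (take j w')) = foldl \<delta> q\<^sub>0 (take i w)"
          using return[of w' i j] w' \<open>i < j\<close> j(2) q' IH by simp
        moreover have "foldl \<delta> q\<^sub>0 (take i w @ drop i w) \<in> F" using w by simp
        ultimately show ?thesis by (rule unique)
      qed
      then show ?case using IH w w' i by (simp add: take_Suc_conv_app_nth)
    qed simp
    show "w = w'" using prefix[of l] w w' by simp
  qed
  moreover have finE: "finite (Q \<rightarrow>\<^sub>E ?E)"
    using assms(1) finite_states by (intro finite_PiE) auto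
  ultimately have "card ?W \<le> card (Q \<rightarrow>\<^sub>E ?E)" by (intro card_inj_on_le)
  also have "\<dots> = card ?E ^ card Q" using finite_states by (simp add: card_PiE)
  also have "card ?E = l * card \<Sigma> + 1"
    using assms(1) by (subst card_insert_disjoint) (auto simp: card_image card_cartesian_product)
  finally show ?thesis .
qed

end

section \<open>Sums of boundedly many elements\<close>

text \<open>The number of summands is fixed rather than bounded: adding \<open>b\<close> to every
  element of \<open>X\<close> shifts a sum of \<open>c\<close> of them by exactly
  \<open>c * b\<close>.\<close>

definition sum_of_exactly :: "nat \<Rightarrow> nat set \<Rightarrow> nat \<Rightarrow> bool" where
  "sum_of_exactly c X n \<longleftrightarrow> (\<exists>xs. length xs = c \<and> set xs \<subseteq> X \<and> sum_list xs = n)"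

lemma sum_of_exactly_0: "sum_of_exactly 0 X 0"
  unfolding sum_of_exactly_def by simp

lemma sum_of_exactly_add:
  assumes "sum_of_exactly c X n" "sum_of_exactly c' X n'"
  shows "sum_of_exactly (c + c') X (n + n')"
proof -
  obtain xs ys where "length xs = c" "set xs \<subseteq> X" "sum_list xs = n"
    "length ys = c'" "set ys \<subseteq> X" "sum_list ys = n'"
    using assms unfolding sum_of_exactly_def by blast
  then show ?thesis unfolding sum_of_exactly_def by (intro exI[of _ "xs @ ys"]) auto
qed

lemma sum_of_exactly_replicate: "x \<in> X \<Longrightarrow> sum_of_exactly c X (c * x)"
  unfolding sum_of_exactly_def by (intro exI[of _ "replicate c x"]) (auto simp: sum_list_replicate)

lemma sum_of_exactly_affine:
  assumes "sum_of_exactly c X n" "\<And>x. x \<in> X \<Longrightarrow> b + d * x \<in> Y"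
  shows "sum_of_exactly c Y (c * b + d * n)"
proof -
  obtain xs where "length xs = c" "set xs \<subseteq> X" "sum_list xs = n"
    using assms(1) unfolding sum_of_exactly_def by blast
  then show ?thesis
    using assms(2) unfolding sum_of_exactly_def
    by (intro exI[of _ "map (\<lambda>x. b + d * x) xs"])
      (auto simp: sum_list_addf sum_list_const_mult map_replicate_const sum_list_replicate)
qed

lemma sum_of_exactly_mono: "sum_of_exactly c X n \<Longrightarrow> X \<subseteq> Y \<Longrightarrow> sum_of_exactly c Y n"
  unfolding sum_of_exactly_def by blast

lemma sum_of_exactly_le:
  assumes "sum_of_exactly c X n" "\<And>x. x \<in> X \<Longrightarrow> x \<le> b"
  shows "n \<le> c * b"
proof -
  obtain xs where "length xs = c" "set xs \<subseteq> X" "sum_list xs = n"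
    using assms(1) unfolding sum_of_exactly_def by blast
  then show ?thesis using assms(2) sum_list_mono[of xs "\<lambda>x. x" "\<lambda>_. b"]
    by (auto simp: map_replicate_const sum_list_replicate)
qed

section \<open>Sums of numbers with base-\<open>K\<close> digits 0 and 1\<close>

fun binary_numbers :: "nat \<Rightarrow> nat \<Rightarrow> nat set" where
  "binary_numbers K 0 = {0}"
| "binary_numbers K (Suc j) = {\<epsilon> + K * e | \<epsilon> e. \<epsilon> \<le> 1 \<and> e \<in> binary_numbers K j}"

lemma zero_in_binary_numbers: "0 \<in> binary_numbers K j"
  by (induction j) force+

lemma sum_list_map2:
  fixes xs ys :: "nat list"
  assumes "length xs = length ys"
  shows "sum_list (map2 (\<lambda>x y. x + K * y) xs ys) = sum_list xs + K * sum_list ys"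
  using assms by (induction xs ys rule: list_induct2) (auto simp: algebra_simps)

text \<open>Each base-\<open>K\<close> digit of \<open>t\<close> is at most \<open>K - 1\<close>,
  hence a sum of \<open>K - 1\<close> bits. Doing this at every position involves no
  carries.\<close>

lemma sum_of_binary_numbers:
  assumes "2 \<le> K" "t < K ^ j"
  shows "sum_of_exactly (K - 1) (binary_numbers K j) t"
  using assms(2)
proof (induction j arbitrary: t)
  case 0
  then show ?case using sum_of_exactly_replicate[of 0 "{0}" "K - 1"] by simp
next
  case (Suc j)
  have "t div K < K ^ j" using Suc.prems assms(1) by (simp add: less_mult_imp_div_less mult.commute)
  from Suc.IH[OF this] obtain es where es: "length es = K - 1" "set es \<subseteq> binary_numbers K j"
    "sum_list es = t div K" unfolding sum_of_exactly_def by blast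
  \<comment> \<open>The lowest digit \<open>t mod K\<close> as that many ones, padded with zeros so
    that each bit is paired with one summand for the higher digits.\<close>
  let ?bits = "replicate (t mod K) 1 @ replicate (K - 1 - t mod K) (0::nat)"
  have len: "length ?bits = K - 1" using mod_less_divisor[of K t] assms(1) by (simp del: mod_less_divisor)
  let ?xs = "map2 (\<lambda>\<epsilon> e. \<epsilon> + K * e) ?bits es"
  have "sum_list ?xs = sum_list ?bits + K * sum_list es"
    using len es(1) by (intro sum_list_map2) simp
  then have "sum_list ?xs = t" using es(3) by (simp add: sum_list_replicate)
  moreover have "set ?xs \<subseteq> binary_numbers K (Suc j)"
  proof
    fix s assume "s \<in> set ?xs"
    then obtain \<epsilon> e where "(\<epsilon>, e) \<in> set (zip ?bits es)" "s = \<epsilon> + K * e" by auto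
    moreover from this(1) have "\<epsilon> \<in> set ?bits" "e \<in> set es"
      by (rule set_zip_leftD, rule set_zip_rightD)
    moreover from this(1) have "\<epsilon> \<le> 1" by (auto simp: set_replicate_conv_if split: if_splits)
    moreover have "e \<in> binary_numbers K j" using \<open>e \<in> set es\<close> es(2) by blast
    ultimately show "s \<in> binary_numbers K (Suc j)" by auto
  qed
  ultimately show ?case unfolding sum_of_exactly_def using len es(1)
    by (intro exI[of _ ?xs]) simp
qed

text \<open>Greedy splitting of \<open>t\<close> into \<open>R\<close> parts of size at most
  \<open>K ^ j - 1\<close>, each costing \<open>K - 1\<close> summands.\<close>

lemma sum_of_binary_numbers_multiple:
  assumes "2 \<le> K" "t \<le> R * (K ^ j - 1)"
  shows "sum_of_exactly ((K - 1) * R) (binary_numbers K j) t"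
  using assms(2)
proof (induction R arbitrary: t)
  case 0
  then show ?case by (simp add: sum_of_exactly_0)
next
  case (Suc R)
  define s where "s = min t (K ^ j - 1)"
  have "s < K ^ j" using assms(1) unfolding s_def by (simp add: min_less_iff_disj)
  moreover have "t - s \<le> R * (K ^ j - 1)" using Suc.prems unfolding s_def by (simp add: min_def) linarith
  ultimately have "sum_of_exactly (K - 1 + (K - 1) * R) (binary_numbers K j) (s + (t - s))"
    by (intro sum_of_exactly_add sum_of_binary_numbers assms(1) Suc.IH)
  moreover have "s + (t - s) = t" unfolding s_def by simp
  ultimately show ?case by simp
qed

text \<open>
  The residue class is reached by some sum since the residues of sums form an ideal; the sum is
  shortened by viewing it as a run of the automaton that adds modulo \<open>D\<close>.
\<close>

lemma sum_of_few_in_residue_class: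
  assumes "Gcd X = 1" "0 < D"
  obtains c n where "c < D" "sum_of_exactly c X n" "[n = r] (mod D)"
proof -
  define H where "H = {r. \<exists>xs. set xs \<subseteq> X \<and> [sum_list xs = r] (mod D)}"
  have H0: "0 \<in> H" unfolding H_def by (auto intro!: exI[of _ "[]"])
  have HX: "x \<in> H" if "x \<in> X" for x
    using that unfolding H_def by (auto intro!: exI[of _ "[x]"])
  have Hadd: "a + b \<in> H" if ab: "a \<in> H" "b \<in> H" for a b
  proof -
    obtain xs ys where "set xs \<subseteq> X" "[sum_list xs = a] (mod D)" "set ys \<subseteq> X" "[sum_list ys = b] (mod D)"
      using ab unfolding H_def by blast
    then show ?thesis unfolding H_def by (auto intro!: exI[of _ "xs @ ys"] cong_add)
  qed
  have Hmult: "i * a \<in> H" if "a \<in> H" for i a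
    using that by (induction i) (auto intro: H0 Hadd)
  have Hcong: "b \<in> H" if "a \<in> H" "[a = b] (mod D)" for a b
    using that unfolding H_def by (auto intro: cong_trans)
  have "D \<in> H" by (rule Hcong[OF H0]) (simp add: cong_def)
  define g where "g = (LEAST g. 0 < g \<and> g \<in> H)"
  have g: "0 < g" "g \<in> H"
    using LeastI[of "\<lambda>g. 0 < g \<and> g \<in> H" D] \<open>D \<in> H\<close> assms(2) unfolding g_def by auto
  have "g dvd a" if "a \<in> H" for a
  proof -
    \<comment> \<open>Sums allow no subtraction; modulo \<open>D\<close>, adding
      \<open>D - 1\<close> copies of \<open>a div g * g\<close> has the effect of subtracting it and
      leaves \<open>a mod g\<close>.\<close>
    have "a + (D - 1) * (a div g * g) = a mod g + D * (a div g * g)"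
      using assms(2) by (cases D) (auto simp: algebra_simps)
    moreover have "[a mod g + D * (a div g * g) = a mod g] (mod D)"
      by (simp add: cong_def)
    moreover have "a + (D - 1) * (a div g * g) \<in> H"
      by (intro Hadd Hmult that g(2))
    ultimately have "a mod g \<in> H" using Hcong by metis
    moreover have "a mod g < g" using g(1) by simp
    ultimately show ?thesis
      using not_less_Least[of "a mod g" "\<lambda>g. 0 < g \<and> g \<in> H"] unfolding g_def[symmetric]
      by (simp add: mod_eq_0_iff_dvd)
  qed
  then have "g dvd Gcd X" using HX by (intro Gcd_greatest) auto
  then have "1 \<in> H" using assms(1) g by simp
  then have "r \<in> H" using Hmult[of 1 r] by simp
  then obtain xs where xs: "set xs \<subseteq> X" "[sum_list xs = r] (mod D)" unfolding H_def by blast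
  interpret automaton X "{..<D}" "\<lambda>s x. (s + x) mod D"
    using assms(2) by unfold_locales auto
  have run: "foldl (\<lambda>s x. (s + x) mod D) s ys = (s + sum_list ys) mod D" if "s < D" for s ys
    using that
  proof (induction ys arbitrary: s)
    case (Cons y ys)
    then show ?case using assms(2) by (simp add: mod_add_left_eq add.assoc)
  qed simp
  obtain ys where "set ys \<subseteq> X" "length ys < D" "sum_list ys mod D = sum_list xs mod D"
    using short_word[of 0 xs] xs(1) assms(2) by (auto simp: run)
  then show ?thesis
    using that[of "length ys" "sum_list ys"] xs(2) unfolding sum_of_exactly_def cong_def by auto
qed

text \<open>
  With \<open>j\<close> maximal such that \<open>c B j + D b \<le> n\<close>, the summands are \<open>c\<close> members of the \<open>j\<close>-th progression,
  at most \<open>c \<rho>\<close> further copies of \<open>B j\<close>, and fewer than \<open>D\<close> elements below \<open>b\<close>. The value of \<open>c\<close> makes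
  the progression of \<open>c\<close>-fold sums at least \<open>b + B j\<close> terms long.
\<close>

lemma sum_of_bounded_number:
  fixes S :: "nat set" and B :: "nat \<Rightarrow> nat"
  assumes K: "2 \<le> K" and D: "0 < D"
    and progression: "\<And>j e. e \<in> binary_numbers K j \<Longrightarrow> B j + D * e \<in> S"
    and B_le: "\<And>j. B j \<le> P * K ^ j"
    and B_ge: "\<And>j. 1 \<le> j \<Longrightarrow> j \<le> B j"
    and B_Suc: "\<And>j. 1 \<le> j \<Longrightarrow> B (Suc j) \<le> \<rho> * B j"
    and small: "Gcd (S \<inter> {..<b}) = 1"
    and c: "c = (K - 1) * (2 * (P + b))" and n: "c * B 1 + D * b \<le> n"
  obtains c' where "c' \<le> c + c * \<rho> + D" "c \<le> c'" "sum_of_exactly c' S n"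
proof -
  have B_in: "B j \<in> S" for j using progression[of 0 j] zero_in_binary_numbers by simp
  have "b \<noteq> 0" using small by (intro notI) simp
  then have c_pos: "0 < c" using c K by simp
  let ?J = "{j. 1 \<le> j \<and> c * B j + D * b \<le> n}"
  have "?J \<subseteq> {..n}"
  proof
    fix j assume j: "j \<in> ?J"
    have "j \<le> B j" using j B_ge by simp
    also have "\<dots> \<le> c * B j" using c_pos by simp
    finally show "j \<in> {..n}" using j by simp
  qed
  then have fin: "finite ?J" using finite_subset by blast
  define j where "j = Max ?J"
  have "?J \<noteq> {}" using n by (auto intro: exI[of _ 1])
  then have j: "1 \<le> j" "c * B j + D * b \<le> n" using Max_in[OF fin] unfolding j_def by auto
  have "Suc j \<notin> ?J" using Max_ge[OF fin, of "Suc j"] unfolding j_def by auto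
  then have n_less: "n < c * B (Suc j) + D * b" by simp
  have B_pos: "0 < B j" using B_ge[OF j(1)] j(1) by linarith
  \<comment> \<open>The amount \<open>D * b\<close> is held back from the copies of
    \<open>B j\<close>, so that the residue-correcting sum \<open>s \<le> D * b\<close> can later be
    subtracted.\<close>
  define r where "r = n - (c * B j + D * b)"
  define i where "i = r div B j"
  have "r < c * B (Suc j)" using n_less j(2) unfolding r_def by linarith
  also have "\<dots> \<le> c * \<rho> * B j" using B_Suc[OF j(1)] by (simp add: mult.assoc)
  finally have i: "i \<le> c * \<rho>" unfolding i_def
    using B_pos by (simp add: less_imp_le less_mult_imp_div_less)
  have n_eq: "n = (c + i) * B j + (D * b + r mod B j)"
    using j(2) unfolding i_def r_def
    by (metis (no_types, lifting) add.commute add.left_commute add_mult_distrib div_mult_mod_eq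
        le_add_diff_inverse2)
  obtain a s where s: "a < D" "sum_of_exactly a (S \<inter> {..<b}) s" "[s = D * b + r mod B j] (mod D)"
    using sum_of_few_in_residue_class[OF small D] by metis
  have "s \<le> a * b" using s(2) by (rule sum_of_exactly_le) auto
  then have s_le: "s \<le> D * b" using s(1) by (meson less_imp_le mult_le_mono1 order_trans)
  define t where "t = (D * b + r mod B j - s) div D"
  have "D dvd D * b + r mod B j - s" 
    using s(3) s_le mod_eq_dvd_iff_nat[of s "D * b + r mod B j" D] by (simp add: cong_def)
  then have t: "s + D * t = D * b + r mod B j" unfolding t_def using s_le by simp
  have "D * t \<le> D * b + r mod B j" using t by linarith
  also have "\<dots> \<le> D * b + D * B j"
    using B_pos D by (intro add_left_mono) (metis le_trans less_imp_le mod_less_divisor mult_le_mono1 nat_mult_1 Suc_leI One_nat_def)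
  finally have "t \<le> b + B j" using D by (simp flip: distrib_left)
  also have "\<dots> \<le> (P + b) * K ^ j"
  proof -
    have "1 \<le> K ^ j" using K by simp
    from mult_le_mono2[OF this, of b] have "b \<le> b * K ^ j" by (simp only: mult_1_right)
    then show ?thesis using B_le[of j] unfolding distrib_right by linarith
  qed
  \<comment> \<open>The factor 2 in \<open>c\<close> is spent here: a block of \<open>K - 1\<close>
    summands reaches only up to \<open>K ^ j - 1\<close>, which is at least half of
    \<open>K ^ j\<close> as \<open>j \<ge> 1\<close>.\<close>
  also have "\<dots> \<le> (P + b) * (2 * (K ^ j - 1))"
  proof (rule mult_left_mono)
    have "2 \<le> K ^ j" using K j(1) by (metis order.trans power_increasing power_one_right Suc_1 le_SucI One_nat_def Suc_le_eq le_trans zero_less_Suc)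
    then show "K ^ j \<le> 2 * (K ^ j - 1)" by linarith
  qed simp
  also have "\<dots> = 2 * (P + b) * (K ^ j - 1)" by simp
  finally have "sum_of_exactly c (binary_numbers K j) t"
    unfolding c by (rule sum_of_binary_numbers_multiple[OF K])
  then have "sum_of_exactly c S (c * B j + D * t)"
    by (rule sum_of_exactly_affine) (rule progression)
  moreover have "sum_of_exactly i S (i * B j)" by (rule sum_of_exactly_replicate[OF B_in])
  moreover have "sum_of_exactly a S s" using s(2) by (rule sum_of_exactly_mono) simp
  ultimately have "sum_of_exactly (c + i + a) S (c * B j + D * t + i * B j + s)"
    by (intro sum_of_exactly_add)
  moreover have "c * B j + D * t + i * B j + s = n" using n_eq t by (simp add: algebra_simps)
  ultimately show ?thesis using that[of "c + i + a"] i s(1) by auto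
qed

section \<open>Expansions and their residual languages\<close>

lemma horner_sum_less:
  "set w \<subseteq> {..<k} \<Longrightarrow> horner_sum id k w < k ^ length w" for k :: nat
proof (induction w)
  case (Cons a w)
  then have "a < k" "Suc (horner_sum id k w) \<le> k ^ length w"
    by (auto simp: id_def)
  then have "a + k * horner_sum id k w < k * Suc (horner_sum id k w)" by simp
  also have "\<dots> \<le> k * k ^ length w" by (intro mult_le_mono2) fact
  finally show ?case by (simp add: id_def)
qed simp

lemma canonical_word_exists:
  assumes "2 \<le> k"
  obtains w where "canonical_word k w" "horner_sum id k w = n"
proof -
  have "\<exists>w. canonical_word k w \<and> horner_sum id k w = n"
  proof (induction n rule: less_induct)
    case (less n)
    show ?case
    proof (cases "n = 0")
      case False
      then obtain w where w: "canonical_word k w" "horner_sum id k w = n div k"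
        using less[of "n div k"] assms by (auto simp: id_def)
      have "n mod k \<noteq> 0" if "w = []"
        using that w(2) False by (metis div_mult_mod_eq horner_sum_simps(1) mult_0 add_0)
      then have "canonical_word k (n mod k # w)"
        using w(1) assms unfolding canonical_word_def by auto
      then show ?thesis using w(2) by (intro exI[of _ "n mod k # w"]) (simp add: id_def)
    qed (auto intro: exI[of _ "[]"] simp: canonical_word_def)
  qed
  then show ?thesis using that by blast
qed

lemma horner_sum_canonical_ge:
  assumes "canonical_word k w" "w \<noteq> []"
  shows "k ^ (length w - 1) \<le> horner_sum id k w"
proof -
  have "horner_sum id k w = horner_sum id k (butlast w) + k ^ (length w - 1) * last w"
    using assms(2) horner_sum_append[of id k "butlast w" "[last w]"] by simp
  moreover have "last w \<noteq> 0" using assms unfolding canonical_word_def by blast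
  ultimately show ?thesis by (simp add: trans_le_add2)
qed

lemma expansions_subset: "w \<in> expansions k S \<Longrightarrow> set w \<subseteq> {..<k}"
  unfolding expansions_def canonical_word_def by simp

section \<open>Left quotients as states\<close>

definition derivative :: "'a list set \<Rightarrow> 'a \<Rightarrow> 'a list set" where
  "derivative L a = {w. a # w \<in> L}"

text \<open>The Myhill-Nerode states of \<open>L\<close>: its left quotients by words, with
  \<open>derivative\<close> as transition function. Their number belongs to the language and not to
  an automaton for it.\<close>

definition residuals :: "'a set \<Rightarrow> 'a list set \<Rightarrow> 'a list set set" where
  "residuals \<Sigma> L = foldl derivative L ` {u. set u \<subseteq> \<Sigma>}"

lemma foldl_derivative: "foldl derivative L u = {w. u @ w \<in> L}"
  by (induction u arbitrary: L) (auto simp: derivative_def)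

lemma self_in_residuals: "L \<in> residuals \<Sigma> L"
  unfolding residuals_def by (force intro: image_eqI[of _ _ "[]"])

lemma automaton_residuals:
  assumes "finite (residuals \<Sigma> L)"
  shows "automaton \<Sigma> (residuals \<Sigma> L) derivative"
proof
  fix X a assume "X \<in> residuals \<Sigma> L" "a \<in> \<Sigma>"
  then obtain u where "set u \<subseteq> \<Sigma>" "X = foldl derivative L u" unfolding residuals_def by blast
  then show "derivative X a \<in> residuals \<Sigma> L"
    using \<open>a \<in> \<Sigma>\<close> unfolding residuals_def by (intro image_eqI[of _ _ "u @ [a]"]) auto
qed fact

section \<open>Word counts and sparseness\<close>

lemma counting_le:
  assumes k: "2 \<le> k" and x: "1 \<le> x"
    and words: "\<And>l. card {w \<in> expansions k S. length w = l} \<le> f l" and "mono f"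
  shows "counting S x \<le> (nat \<lfloor>log 2 x\<rfloor> + 2) * f (nat \<lfloor>log 2 x\<rfloor> + 1)"
proof -
  define l where "l = nat \<lfloor>log 2 x\<rfloor> + 1"
  let ?W = "\<lambda>i. {w \<in> expansions k S. length w = i}"
  have fin: "finite (?W i)" for i
    by (rule finite_subset[OF _ finite_lists_length_eq[of "{..<k}" i]]) (auto dest: expansions_subset)
  \<comment> \<open>A canonical word of length \<open>i \<ge> 1\<close> has value at least
    \<open>k ^ (i - 1) \<ge> 2 ^ (i - 1)\<close>, so numbers up to \<open>x\<close> have expansions
    of length at most \<open>log 2 x + 1\<close> in any base.\<close>
  have "{n \<in> S. real n \<le> x} \<subseteq> horner_sum id k ` (\<Union>i\<le>l. ?W i)"
  proof
    fix n assume n: "n \<in> {n \<in> S. real n \<le> x}"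
    obtain w where w: "canonical_word k w" "horner_sum id k w = n"
      using canonical_word_exists[OF k] by blast
    have "length w \<le> l"
    proof (cases "w = []")
      case False
      have "2 ^ (length w - 1) \<le> k ^ (length w - 1)" using k by (rule power_mono) simp
      also have "\<dots> \<le> n" using horner_sum_canonical_ge[OF w(1) False] w(2) by simp
      finally have "real (2 ^ (length w - 1)) \<le> x" using n by (metis (mono_tags, lifting) le_trans mem_Collect_eq of_nat_le_iff order_trans)
      then have "real (length w - 1) \<le> log 2 x"
        using x by (simp add: le_log_iff powr_realpow)
      then show ?thesis unfolding l_def by linarith
    qed simp
    then show "n \<in> horner_sum id k ` (\<Union>i\<le>l. ?W i)"
      using w n unfolding expansions_def by (intro image_eqI[of _ _ w]) auto
  qed
  then have "counting S x \<le> card (\<Union>i\<le>l. ?W i)"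
    unfolding counting_def using fin by (intro surj_card_le) auto
  also have "\<dots> \<le> (\<Sum>i\<le>l. card (?W i))" by (rule card_UN_le) simp
  also have "\<dots> \<le> (\<Sum>i\<le>l. f l)"
    using words \<open>mono f\<close> by (intro sum_mono) (meson atMost_iff monoD order_trans)
  finally show ?thesis unfolding l_def by simp
qed

text \<open>Polynomial growth in the number of digits is polylogarithmic growth in \<open>x\<close>;
  summing over the lengths raises the exponent by one.\<close>

lemma sparse_if_polynomially_many_words:
  assumes k: "2 \<le> k"
    and words: "\<And>l. card {w \<in> expansions k S. length w = l} \<le> (l * c + 1) ^ m"
  shows "sparse S"
  unfolding sparse_def
proof (intro exI bigoI)
  have bound: "norm (real (counting S x)) \<le> (4 * (4 * c + 1) ^ m) * norm (ln x ^ Suc m)"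
    if x: "exp 1 \<le> x" for x
  proof -
    have x1: "1 \<le> x" using x exp_ge_add_one_self[of 1] by linarith
    have ln: "1 \<le> ln x" using x x1 by (simp add: ln_ge_iff)
    have "mono (\<lambda>l. (l * c + 1) ^ m)" by (intro monoI power_mono) auto
    from counting_le[OF k x1 words this]
    have "real (counting S x) \<le> real ((nat \<lfloor>log 2 x\<rfloor> + 2) * ((nat \<lfloor>log 2 x\<rfloor> + 1) * c + 1) ^ m)"
      by (simp only: of_nat_le_iff)
    also have "\<dots> \<le> (4 * ln x) * ((4 * c + 1) * ln x) ^ m"
    proof -
      \<comment> \<open>This holds because \<open>ln (1 / 2) \<le> - 1 / 2\<close>. The condition
        \<open>x \<ge> exp 1\<close> gives \<open>ln x \<ge> 1\<close>, which absorbs the additive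
        constants.\<close>
      have "log 2 x \<le> 2 * ln x"
        using ln ln_le_minus_one[of "1 / 2"] by (simp add: log_def field_simps ln_div)
      moreover have "0 \<le> log 2 x" using x1 by simp
      ultimately have l: "real (nat \<lfloor>log 2 x\<rfloor> + 2) \<le> 4 * ln x" using ln by linarith
      have "real ((nat \<lfloor>log 2 x\<rfloor> + 1) * c + 1) \<le> (4 * ln x) * c + 1 * ln x"
        using l ln by (simp only: of_nat_add of_nat_mult of_nat_1) (intro add_mono mult_right_mono; simp)
      also have "\<dots> = (4 * c + 1) * ln x" by (simp add: algebra_simps)
      finally show ?thesis using l
        by (simp only: of_nat_mult of_nat_power) (intro mult_mono power_mono; simp)
    qed
    also have "\<dots> = (4 * (4 * c + 1) ^ m) * norm (ln x ^ Suc m)"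
      using ln by (simp add: power_mult_distrib)
    finally show ?thesis by simp
  qed
  show "\<forall>\<^sub>F x in at_top. norm (real (counting S x)) \<le> (4 * (4 * c + 1) ^ m) * norm (ln x ^ Suc m)"
    using bound by (auto intro: eventually_mono[OF eventually_ge_at_top[of "exp 1"]])
qed

text \<open>
  A word of length at least \<open>2 m\<close> has two disjoint pumpable factors. Its value is an integer
  combination of the values of the three words obtained by deleting one or both of them.
\<close>

lemma Gcd_small_elements:
  assumes k: "2 \<le> k" and fin: "finite (residuals {..<k} (expansions k S))" and "Gcd S = 1"
    and m: "m = card (residuals {..<k} (expansions k S))"
  shows "Gcd (S \<inter> {..<k ^ (2 * m)}) = 1"
proof -
  let ?L = "expansions k S" and ?v = "horner_sum id k"
  define g where "g = Gcd (S \<inter> {..<k ^ (2 * m)})"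
  interpret automaton "{..<k}" "residuals {..<k} ?L" derivative
    by (rule automaton_residuals[OF fin])
  have "g dvd ?v w" if "w \<in> ?L" for w
    using that
  proof (induction w rule: length_induct)
    case (1 w)
    show ?case
    proof (cases "length w < 2 * m")
      case True
      have "?v w < k ^ length w" using horner_sum_less expansions_subset[OF "1.prems"] by blast
      also have "\<dots> \<le> k ^ (2 * m)" using True k by (intro power_increasing) auto
      finally have "?v w \<in> S \<inter> {..<k ^ (2 * m)}" using "1.prems" unfolding expansions_def by simp
      then show ?thesis unfolding g_def by (rule Gcd_dvd)
    next
      case False
      have \<Sigma>: "set w \<subseteq> {..<k}" by (rule expansions_subset[OF "1.prems"])
      have w_split: "w = take m w @ drop m w" by simp
      have take_\<Sigma>: "set (take m w) \<subseteq> {..<k}" and drop_\<Sigma>: "set (drop m w) \<subseteq> {..<k}"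
        using \<Sigma> set_take_subset set_drop_subset by fast+
      obtain x y t where xyt: "take m w = x @ y @ t" "y \<noteq> []"
        "foldl derivative ?L (x @ y) = foldl derivative ?L x"
        by (rule pumping[OF self_in_residuals take_\<Sigma>]) (use False m in auto)
      \<comment> \<open>The second factor is sought in \<open>drop m w\<close>, from the state
        reached after the first \<open>m\<close> letters, so that the two factors are
        disjoint.\<close>
      obtain x' y' t' where xyt': "drop m w = x' @ y' @ t'" "y' \<noteq> []"
        "foldl derivative (foldl derivative ?L (take m w)) (x' @ y') =
         foldl derivative (foldl derivative ?L (take m w)) x'"
        by (rule pumping[OF run_in_states[OF self_in_residuals take_\<Sigma>] drop_\<Sigma>]) (use False m in auto)
      have del: "x @ v \<in> ?L \<longleftrightarrow> x @ y @ v \<in> ?L" for v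
        using xyt(3) unfolding foldl_derivative by (metis (lifting) append.assoc mem_Collect_eq)
      have del': "take m w @ x' @ v \<in> ?L \<longleftrightarrow> take m w @ x' @ y' @ v \<in> ?L" for v
        using xyt'(3) unfolding foldl_append[symmetric] foldl_derivative
        by (metis (lifting) append.assoc mem_Collect_eq)
      let ?p = "t @ x' @ y' @ t'" and ?q = "t @ x' @ t'"
      have w: "w = x @ y @ ?p" using xyt(1) xyt'(1) w_split by simp
      have in_L: "x @ ?p \<in> ?L" "x @ y @ ?q \<in> ?L" "x @ ?q \<in> ?L"
        using "1.prems" del del' w xyt(1) by (metis append.assoc)+
      have dvd: "g dvd ?v (x @ ?p)" "g dvd ?v (x @ y @ ?q)" "g dvd ?v (x @ ?q)"
        using xyt(2) xyt'(2) by (intro "1.IH"[rule_format] in_L; simp add: w)+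
      \<comment> \<open>The difference \<open>?v (x @ y @ r) - k ^ length y * ?v (x @ r)\<close>
        does not depend on \<open>r\<close>. It is compared for \<open>?p\<close> and
        \<open>?q\<close>, written without subtraction.\<close>
      have "?v (x @ y @ ?p) + k ^ length y * ?v (x @ ?q) =
        ?v (x @ y @ ?q) + k ^ length y * ?v (x @ ?p)"
        by (simp add: horner_sum_append algebra_simps power_add)
      then have "g dvd ?v (x @ y @ ?p) + k ^ length y * ?v (x @ ?q)" using dvd by simp
      then show ?thesis using dvd(3) dvd_add_left_iff dvd_mult unfolding w by blast
    qed
  qed
  then have "g dvd n" if "n \<in> S" for n
    using canonical_word_exists[OF k, of n] that unfolding expansions_def by blast
  then have "g dvd Gcd S" by (rule Gcd_greatest)
  then show ?thesis using assms(3) unfolding g_def by simp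
qed

text \<open>Without two loops starting with different letters at one state that leads to acceptance,
  \<open>card_accepted_words_le\<close> would make \<open>S\<close> sparse. The words involved are
  then shortened, and joining the two loops in both orders gives equal lengths and distinct
  values.\<close>

lemma two_loops:
  assumes k: "2 \<le> k" and fin: "finite (residuals {..<k} (expansions k S))" and "\<not> sparse S"
    and m: "m = card (residuals {..<k} (expansions k S))"
  obtains u v v' w where "set u \<subseteq> {..<k}" "set v \<subseteq> {..<k}" "set v' \<subseteq> {..<k}" "set w \<subseteq> {..<k}"
    and "length u < m" "length w < m" "length v = length v'" "v \<noteq> []" "length v \<le> 2 * m"
    and "horner_sum id k v' < horner_sum id k v"
    and "foldl derivative (expansions k S) (u @ v) = foldl derivative (expansions k S) u"
    and "foldl derivative (expansions k S) (u @ v') = foldl derivative (expansions k S) u"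
    and "u @ w \<in> expansions k S"
proof -
  let ?L = "expansions k S" and ?\<delta> = "foldl derivative"
  interpret automaton "{..<k}" "residuals {..<k} ?L" derivative
    by (rule automaton_residuals[OF fin])
  have accepted: "[] \<in> ?\<delta> ?L w \<longleftrightarrow> w \<in> ?L" for w
    by (simp add: foldl_derivative)
  have "\<exists>u a y b z w. a \<noteq> b \<and> set (u @ a # y @ b # z @ w) \<subseteq> {..<k} \<and>
      ?\<delta> ?L (u @ a # y) = ?\<delta> ?L u \<and> ?\<delta> ?L (u @ b # z) = ?\<delta> ?L u \<and> u @ w \<in> ?L"
  proof (rule ccontr)
    assume no_branch: "\<not> ?thesis"
    have unique: "a = b" if "set (u @ a # y @ b # z @ w) \<subseteq> {..<k}"
      "?\<delta> ?L (u @ a # y) = ?\<delta> ?L u" "?\<delta> ?L (u @ b # z) = ?\<delta> ?L u" "?\<delta> ?L (u @ w) \<in> {X. [] \<in> X}"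
      for u a y b z w
      using that no_branch unfolding mem_Collect_eq accepted by blast
    have "sparse S"
    proof (rule sparse_if_polynomially_many_words[OF k])
      fix l
      have "card {w. set w \<subseteq> {..<k} \<and> length w = l \<and> ?\<delta> ?L w \<in> {X. [] \<in> X}}
          \<le> (l * card {..<k} + 1) ^ card (residuals {..<k} ?L)"
        by (rule card_accepted_words_le[OF finite_lessThan self_in_residuals unique])
      moreover have "{w. set w \<subseteq> {..<k} \<and> length w = l \<and> ?\<delta> ?L w \<in> {X. [] \<in> X}} =
          {w \<in> ?L. length w = l}"
        using expansions_subset by (auto simp: accepted)
      ultimately show "card {w \<in> ?L. length w = l} \<le> (l * k + 1) ^ card (residuals {..<k} ?L)"
        by simp
    qed
    then show False using assms(3) by blast
  qed
  then obtain u a y b z w where ab: "a \<noteq> b" and \<Sigma>: "set (u @ a # y @ b # z @ w) \<subseteq> {..<k}"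
    and loops: "?\<delta> ?L (u @ a # y) = ?\<delta> ?L u" "?\<delta> ?L (u @ b # z) = ?\<delta> ?L u" and "u @ w \<in> ?L"
    by blast
  have "set u \<subseteq> {..<k}" "set y \<subseteq> {..<k}" "set z \<subseteq> {..<k}" "set w \<subseteq> {..<k}" "a < k" "b < k"
    using \<Sigma> by auto
  define q where "q = ?\<delta> ?L u"
  have q: "q \<in> residuals {..<k} ?L"
    unfolding q_def by (intro run_in_states self_in_residuals) fact
  have qa: "derivative q a \<in> residuals {..<k} ?L" "derivative q b \<in> residuals {..<k} ?L"
    using step[OF q] \<open>a < k\<close> \<open>b < k\<close> by auto
  obtain u' where u': "set u' \<subseteq> {..<k}" "length u' < m" "?\<delta> ?L u' = ?\<delta> ?L u"
    using short_word[OF self_in_residuals \<open>set u \<subseteq> {..<k}\<close>] m by blast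
  \<comment> \<open>Only the part after the first letter is shortened, so that the loops still start
    with \<open>a\<close> and \<open>b\<close>.\<close>
  obtain y' where y': "set y' \<subseteq> {..<k}" "length y' < m"
    "?\<delta> (derivative q a) y' = ?\<delta> (derivative q a) y"
    using short_word[OF qa(1) \<open>set y \<subseteq> {..<k}\<close>] m by blast
  obtain z' where z': "set z' \<subseteq> {..<k}" "length z' < m"
    "?\<delta> (derivative q b) z' = ?\<delta> (derivative q b) z"
    using short_word[OF qa(2) \<open>set z \<subseteq> {..<k}\<close>] m by blast
  obtain w' where w': "set w' \<subseteq> {..<k}" "length w' < m" "?\<delta> q w' = ?\<delta> q w"
    using short_word[OF q \<open>set w \<subseteq> {..<k}\<close>] m by blast
  have loop_a: "?\<delta> q (a # y') = q" and loop_b: "?\<delta> q (b # z') = q"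
    using loops y'(3) z'(3) unfolding q_def by simp_all
  have u'w': "u' @ w' \<in> ?L"
    using \<open>u @ w \<in> ?L\<close> w'(3) u'(3) unfolding accepted[symmetric] q_def by simp
  define p where "p = (a # y') @ (b # z')"
  define p' where "p' = (b # z') @ (a # y')"
  have p: "set p \<subseteq> {..<k}" "set p' \<subseteq> {..<k}" "length p = length p'" "p \<noteq> []" "p' \<noteq> []"
    "length p \<le> 2 * m"
    using y' z' \<open>a < k\<close> \<open>b < k\<close> unfolding p_def p'_def by auto
  have "?\<delta> q p = q" "?\<delta> q p' = q"
    unfolding p_def p'_def foldl_append loop_a loop_b by simp_all
  then have pq: "?\<delta> ?L (u' @ p) = ?\<delta> ?L u'" "?\<delta> ?L (u' @ p') = ?\<delta> ?L u'"
    using u'(3) unfolding q_def by simp_all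
  \<comment> \<open>The first letter is the least significant digit, so the two values differ modulo
    \<open>k\<close>.\<close>
  have "horner_sum id k p mod k = a" "horner_sum id k p' mod k = b"
    using \<open>a < k\<close> \<open>b < k\<close> unfolding p_def p'_def by simp_all
  then consider "horner_sum id k p' < horner_sum id k p" | "horner_sum id k p < horner_sum id k p'"
    using ab by (metis nat_neq_iff)
  then show ?thesis
  proof cases
    case 1
    show ?thesis
      by (rule that[of u' p p' w']) (use u'(1,2) w'(1,2) p 1 pq u'w' in auto)
  next
    case 2
    show ?thesis
      by (rule that[of u' p' p w']) (use u'(1,2) w'(1,2) p 2 pq u'w' in auto)
  qed
qed

text \<open>A run of \<open>j\<close> loops at \<open>q\<close>, each \<open>v\<close> or
  \<open>v'\<close>. Exchanging \<open>v'\<close> for \<open>v\<close> in block \<open>i\<close>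
  adds the difference of their values times \<open>k ^ (length v * i)\<close>, so the digits 1 of
  \<open>e\<close> mark the blocks \<open>v\<close>.\<close>

lemma loop_words:
  fixes k :: nat
  assumes "length v = length v'" "horner_sum id k v' \<le> horner_sum id k v"
    and \<Sigma>: "set v \<subseteq> {..<k}" "set v' \<subseteq> {..<k}" and loops: "foldl \<delta> q v = q" "foldl \<delta> q v' = q"
    and "e \<in> binary_numbers (k ^ length v) j"
  shows "\<exists>z. set z \<subseteq> {..<k} \<and> length z = length v * j \<and> foldl \<delta> q z = q \<and>
    horner_sum id k z = horner_sum id k (concat (replicate j v')) +
      (horner_sum id k v - horner_sum id k v') * e"
proof -
  define d where "d = horner_sum id k v - horner_sum id k v'"
  have d: "horner_sum id k v = horner_sum id k v' + d" using assms(2) unfolding d_def by simp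
  have "\<exists>z. set z \<subseteq> {..<k} \<and> length z = length v * j \<and> foldl \<delta> q z = q \<and>
    horner_sum id k z = horner_sum id k (concat (replicate j v')) + d * e"
    using assms(7)
  proof (induction j arbitrary: e)
    case (Suc j)
    then obtain \<epsilon> e' where e: "e = \<epsilon> + k ^ length v * e'" "\<epsilon> \<le> 1"
      "e' \<in> binary_numbers (k ^ length v) j"
      by auto
    obtain z where z: "set z \<subseteq> {..<k}" "length z = length v * j" "foldl \<delta> q z = q"
      "horner_sum id k z = horner_sum id k (concat (replicate j v')) + d * e'"
      using Suc.IH[OF e(3)] by blast
    define v'' where "v'' = (if \<epsilon> = 1 then v else v')"
    have v'': "horner_sum id k v'' = horner_sum id k v' + d * \<epsilon>"
      using e(2) d unfolding v''_def by (cases "\<epsilon> = 1") auto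
    have "length v'' = length v" "set v'' \<subseteq> {..<k}" "foldl \<delta> q v'' = q"
      using assms unfolding v''_def by auto
    moreover from this(1) have "horner_sum id k (v'' @ z) =
        horner_sum id k (concat (replicate (Suc j) v')) + d * e"
      using assms(1)
      by (simp only: horner_sum_append v'' z(4) e(1) replicate_Suc concat.simps) (simp add: algebra_simps)
    ultimately show ?case using z by (intro exI[of _ "v'' @ z"]) (auto simp: id_def)
  qed auto
  then show ?thesis unfolding d_def .
qed

text \<open>The data of \<open>sum_of_bounded_number\<close> are read off from the words of
  \<open>two_loops\<close>, with \<open>\<rho> = k ^ (s + 1)\<close>, and are then bounded by powers
  of \<open>k\<close> with exponents linear in \<open>m\<close>.\<close>

lemma sum_of_at_most_residuals:
  assumes k: "2 \<le> k" and fin: "finite (residuals {..<k} (expansions k S))" and "\<not> sparse S"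
    and Gcd: "Gcd S = 1" and m: "m = card (residuals {..<k} (expansions k S))"
    and n: "3 * k ^ (16 * m + 5) \<le> n"
  shows "sum_of_at_most (5 * k ^ (16 * m + 3)) S n"
proof -
  let ?L = "expansions k S" and ?v = "horner_sum id k"
  obtain u v v' w where \<Sigma>: "set u \<subseteq> {..<k}" "set v \<subseteq> {..<k}" "set v' \<subseteq> {..<k}" "set w \<subseteq> {..<k}"
    and lens: "length u < m" "length w < m" "length v = length v'" "v \<noteq> []" "length v \<le> 2 * m"
    and less: "?v v' < ?v v"
    and loops: "foldl derivative ?L (u @ v) = foldl derivative ?L u"
      "foldl derivative ?L (u @ v') = foldl derivative ?L u"
    and uw: "u @ w \<in> ?L"
    using two_loops[OF k fin assms(3) m] by metis
  define s where "s = length v"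
  define K where "K = k ^ s"
  define P where "P = k ^ (length u + length w)"
  define B where "B j = ?v (u @ concat (replicate j v') @ w)" for j
  \<comment> \<open>The factor \<open>k ^ length u\<close> is the place value at which the blocks
    start.\<close>
  define D where "D = k ^ length u * (?v v - ?v v')"
  define b where "b = k ^ (2 * m)"
  define c where "c = (K - 1) * (2 * (P + b))"
  have s: "0 < s" "s \<le> 2 * m" using lens unfolding s_def by auto
  have K: "2 \<le> K" unfolding K_def using k s(1) self_le_power[of k s] by linarith
  have progression: "\<exists>z. u @ z @ w \<in> ?L \<and> length z = s * j \<and> ?v (u @ z @ w) = B j + D * e"
    if e: "e \<in> binary_numbers K j" for e j
  proof -
    obtain z where z: "length z = s * j" "foldl derivative ?L (u @ z) = foldl derivative ?L u"
      "?v z = ?v (concat (replicate j v')) + (?v v - ?v v') * e"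
      using loop_words[OF lens(3) less_imp_le[OF less] \<Sigma>(2,3) loops[unfolded foldl_append]
          e[unfolded K_def s_def]]
      unfolding s_def foldl_append by blast
    have "length (concat (replicate j v')) = s * j"
      using lens(3) unfolding s_def by (induction j) auto
    then have "?v (u @ z @ w) = B j + D * e"
      using z(1,3) unfolding B_def D_def by (simp add: horner_sum_append algebra_simps)
    moreover have "u @ z @ w \<in> ?L"
      using z(2) uw unfolding foldl_derivative by (metis (lifting) append.assoc mem_Collect_eq)
    ultimately show ?thesis using z(1) by blast
  qed
  have B_word: "\<exists>x. x \<in> ?L \<and> length x = length u + s * j + length w \<and> ?v x = B j" for j
    using progression[OF zero_in_binary_numbers, of j] by force
  have B_less: "B j < k ^ (length u + s * j + length w)" for j
    using B_word[of j] horner_sum_less expansions_subset by metis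
  have B_ge_power: "k ^ (length u + s * j + length w - 1) \<le> B j" if "1 \<le> j" for j
  proof -
    obtain x where x: "x \<in> ?L" "length x = length u + s * j + length w" "?v x = B j"
      using B_word by blast
    moreover have "x \<noteq> []" using x(2) s(1) that by auto
    ultimately show ?thesis
      using horner_sum_canonical_ge[of k x] unfolding expansions_def by auto
  qed
  have B_le: "B j \<le> P * K ^ j" for j
    using B_less[of j] unfolding P_def K_def by (simp add: power_add mult_ac flip: power_mult)
  have B_ge: "j \<le> B j" if "1 \<le> j" for j
  proof -
    have "j \<le> 2 ^ (j - 1)" using less_exp[of "j - 1"] that by linarith
    also have "\<dots> \<le> k ^ (j - 1)" using k by (rule power_mono) simp
    also have "\<dots> \<le> k ^ (length u + s * j + length w - 1)"
    proof (rule power_increasing)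
      have "j \<le> s * j" using s(1) by simp
      then show "j - 1 \<le> length u + s * j + length w - 1" by linarith
    qed (use k in simp)
    finally show ?thesis using B_ge_power[OF that] by linarith
  qed
  \<comment> \<open>The words for \<open>j\<close> and \<open>Suc j\<close> differ in length by
    \<open>s\<close>. A nonempty canonical word of length \<open>l\<close> has a value from
    \<open>k ^ (l - 1)\<close> up to below \<open>k ^ l\<close>, which costs one more factor
    \<open>k\<close>.\<close>
  have B_Suc: "B (Suc j) \<le> k ^ (s + 1) * B j" if "1 \<le> j" for j
  proof -
    have "0 < s * j" using s(1) that by simp
    then have "length u + s * Suc j + length w = (s + 1) + (length u + s * j + length w - 1)"
      by simp
    then have "B (Suc j) \<le> k ^ (s + 1) * k ^ (length u + s * j + length w - 1)"
      using B_less[of "Suc j"] by (simp only: power_add less_imp_le)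
    also have "\<dots> \<le> k ^ (s + 1) * B j" by (intro mult_le_mono2 B_ge_power that)
    finally show ?thesis .
  qed
  have D_pos: "0 < D" using less k unfolding D_def by simp
  have in_S: "B j + D * e \<in> S" if "e \<in> binary_numbers K j" for j e
    using progression[OF that] unfolding expansions_def by force
  have small: "Gcd (S \<inter> {..<b}) = 1" unfolding b_def by (rule Gcd_small_elements[OF k fin Gcd m])
  have pow: "k ^ i \<le> k ^ j" if "i \<le> j" for i j using that k by (intro power_increasing) auto
  have K_le: "K \<le> k ^ (2 * m)" unfolding K_def by (intro pow s(2))
  have P_le: "P \<le> k ^ (2 * m)" unfolding P_def using lens(1,2) by (intro pow) simp
  have c_le: "c \<le> 4 * k ^ (4 * m)"
  proof -
    have "c \<le> k ^ (2 * m) * (2 * (k ^ (2 * m) + k ^ (2 * m)))"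
      unfolding c_def b_def using K_le P_le by (intro mult_le_mono) auto
    also have "\<dots> = 4 * k ^ (2 * m + 2 * m)" unfolding power_add by simp
    finally show ?thesis by simp
  qed
  have D_le: "D \<le> k ^ (3 * m)"
  proof -
    have "?v v < k ^ s" unfolding s_def by (rule horner_sum_less[OF \<Sigma>(2)])
    also have "\<dots> \<le> k ^ (2 * m)" by (intro pow s(2))
    finally have "D \<le> k ^ m * k ^ (2 * m)"
      unfolding D_def using lens(1) by (intro mult_le_mono pow) auto
    then show ?thesis by (simp flip: power_add)
  qed
  have threshold: "c * B 1 + D * b \<le> n"
  proof -
    have "B 1 \<le> P * K" using B_le[of 1] by simp
    also have "\<dots> \<le> k ^ (2 * m) * k ^ (2 * m)" by (intro mult_le_mono P_le K_le)
    finally have "c * B 1 \<le> (4 * k ^ (4 * m)) * (k ^ (2 * m) * k ^ (2 * m))"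
      by (intro mult_le_mono c_le)
    moreover have "D * b \<le> k ^ (3 * m) * k ^ (2 * m)"
      unfolding b_def by (intro mult_le_mono D_le order_refl)
    ultimately have "c * B 1 + D * b \<le> 4 * k ^ (8 * m) + k ^ (5 * m)"
      by (simp add: mult.assoc flip: power_add)
    also have "\<dots> \<le> 5 * k ^ (8 * m)" using pow[of "5 * m" "8 * m"] by simp
    \<comment> \<open>Surplus constants are traded for a factor \<open>k \<ge> 2\<close>, here by
      \<open>5 \<le> 3 * k\<close> and later by \<open>9 \<le> 5 * k\<close>; the exponents have
      ample room for it.\<close>
    also have "\<dots> \<le> 3 * (k * k ^ (8 * m))" using mult_le_mono1[OF k, of "k ^ (8 * m)"] by linarith
    also have "\<dots> \<le> 3 * k ^ (16 * m + 5)" using pow[of "Suc (8 * m)" "16 * m + 5"] by simp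
    finally show ?thesis using n by linarith
  qed
  obtain c' where c': "c' \<le> c + c * k ^ (s + 1) + D" "c \<le> c'" "sum_of_exactly c' S n"
    using sum_of_bounded_number[OF K D_pos in_S B_le B_ge B_Suc small c_def threshold] by metis
  have "c * k ^ (s + 1) \<le> (4 * k ^ (4 * m)) * k ^ (2 * m + 1)"
    using s(2) by (intro mult_le_mono c_le pow) simp
  also have "\<dots> = 4 * k ^ (6 * m + 1)" by (simp add: mult.assoc flip: power_add power_Suc)
  finally have "c' \<le> 4 * k ^ (4 * m) + 4 * k ^ (6 * m + 1) + k ^ (3 * m)"
    using c'(1) c_le D_le by linarith
  also have "\<dots> \<le> 9 * k ^ (6 * m + 1)"
    using pow[of "4 * m" "6 * m + 1"] pow[of "3 * m" "6 * m + 1"] by linarith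
  also have "\<dots> \<le> 5 * (k * k ^ (6 * m + 1))"
    using mult_le_mono1[OF k, of "k ^ (6 * m + 1)"] by linarith
  also have "\<dots> \<le> 5 * k ^ (16 * m + 3)" using pow[of "Suc (6 * m + 1)" "16 * m + 3"] by simp
  finally have "c' \<le> 5 * k ^ (16 * m + 3)" .
  \<comment> \<open>\<open>sum_of_at_most\<close> asks for at least one summand, which is why the
    lower bound \<open>c \<le> c'\<close> was kept.\<close>
  moreover have "1 \<le> c'" using c'(2) K k unfolding c_def b_def by (simp add: Suc_le_eq order.strict_trans2[rotated])
  ultimately show ?thesis
    using c'(3) unfolding sum_of_exactly_def sum_of_at_most_def by blast
qed

section \<open>Computing the number of residuals\<close>

text \<open>Functions take the whole argument list, with the arity \<open>n\<close> fixed outside,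
  so that closure rules compose and no program has to be written out. Binders put their variables at
  the front of the list.\<close>

definition computable :: "nat \<Rightarrow> (nat list \<Rightarrow> nat) \<Rightarrow> bool" where
  "computable n F \<longleftrightarrow> (\<exists>f. \<forall>xs. length xs = n \<longrightarrow> evaluates f xs (F xs))"

abbreviation decidable :: "nat \<Rightarrow> (nat list \<Rightarrow> bool) \<Rightarrow> bool" where
  "decidable n P \<equiv> computable n (\<lambda>xs. of_bool (P xs))"

named_theorems computable_intros

lemma computable_nth [computable_intros]: "i < n \<Longrightarrow> computable n (\<lambda>xs. xs ! i)"
  unfolding computable_def using evaluates.Proj by blast

lemma computable_hd [computable_intros]: "computable (Suc n) (\<lambda>xs. hd xs)"
  unfolding computable_def
  by (rule exI[of _ "Proj 0"]) (metis evaluates.Proj hd_conv_nth length_0_conv nat.distinct(1) zero_less_Suc)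

lemma evaluates_projections:
  assumes "m \<le> length xs"
  shows "list_all2 (\<lambda>g y. evaluates g xs y) (map Proj [m..<length xs]) (drop m xs)"
  using assms by (auto simp: list_all2_conv_all_nth intro!: evaluates.Proj)

text \<open>Weakening: a function of the parameters stays computable under a binder, whose variable
  is the new head.\<close>

lemma computable_tl:
  assumes "computable n F"
  shows "computable (Suc n) (\<lambda>xs. F (tl xs))"
proof -
  obtain f where f: "\<And>xs. length xs = n \<Longrightarrow> evaluates f xs (F xs)"
    using assms unfolding computable_def by blast
  have "evaluates (Comp f (map Proj [1..<Suc n])) xs (F (tl xs))" if "length xs = Suc n" for xs
    using evaluates_projections[of 1 xs] that f[of "tl xs"]
    by (intro evaluates.Comp[where ys = "tl xs"]) (auto simp: drop_Suc)
  then show ?thesis unfolding computable_def by blast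
qed

lemma computable_tl_hd [computable_intros]: "computable (Suc (Suc n)) (\<lambda>xs. hd (tl xs))"
  by (rule computable_tl[OF computable_hd])

lemma computable_Suc [computable_intros]:
  assumes "computable n F"
  shows "computable n (\<lambda>xs. Suc (F xs))"
proof -
  obtain f where f: "\<And>xs. length xs = n \<Longrightarrow> evaluates f xs (F xs)"
    using assms unfolding computable_def by blast
  have "evaluates (Comp Succ [f]) xs (Suc (F xs))" if "length xs = n" for xs
    using f[OF that] by (intro evaluates.Comp[where ys = "[F xs]"]) (auto intro: evaluates.Succ)
  then show ?thesis unfolding computable_def by blast
qed

lemma computable_const [computable_intros]: "computable n (\<lambda>_. c)"
proof (induction c)
  case 0
  then show ?case unfolding computable_def using evaluates.Zero by blast
qed (rule computable_Suc)

lemma computable_rec_nat [computable_intros]: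
  assumes "computable n F" "computable n B"
    and "computable (Suc (Suc n)) (\<lambda>ys. G (hd ys) (hd (tl ys)) (tl (tl ys)))"
  shows "computable n (\<lambda>xs. rec_nat (F xs) (\<lambda>i y. G i y xs) (B xs))"
proof -
  obtain f where f: "\<And>xs. length xs = n \<Longrightarrow> evaluates f xs (F xs)"
    using assms(1) unfolding computable_def by blast
  obtain b where b: "\<And>xs. length xs = n \<Longrightarrow> evaluates b xs (B xs)"
    using assms(2) unfolding computable_def by blast
  obtain g where g: "\<And>xs. length xs = Suc (Suc n) \<Longrightarrow>
      evaluates g xs (G (hd xs) (hd (tl xs)) (tl (tl xs)))"
    using assms(3) unfolding computable_def by blast
  have rec: "evaluates (PrimRec f g) (j # xs) (rec_nat (F xs) (\<lambda>i y. G i y xs) j)"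
    if "length xs = n" for xs j
  proof (induction j)
    case 0
    show ?case using f[OF that] by (auto intro: evaluates.PrimRec_0)
  next
    case (Suc j)
    show ?case
      using g[of "j # rec_nat (F xs) (\<lambda>i y. G i y xs) j # xs"] that
      by (auto intro: evaluates.PrimRec_Suc[OF Suc])
  qed
  \<comment> \<open>\<open>PrimRec\<close> recurses on its first argument, so the bound is put in
    front of a copy of all parameters.\<close>
  have "evaluates (Comp (PrimRec f g) (b # map Proj [0..<n])) xs
      (rec_nat (F xs) (\<lambda>i y. G i y xs) (B xs))" if "length xs = n" for xs
    using evaluates_projections[of 0 xs] that b[OF that] rec[OF that]
    by (intro evaluates.Comp[where ys = "B xs # xs"]) auto
  then show ?thesis unfolding computable_def by blast
qed


section \<open>Arithmetic and bounded search\<close>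

lemma computable_add [computable_intros]:
  assumes "computable n F" "computable n G"
  shows "computable n (\<lambda>xs. F xs + G xs)"
proof -
  have "rec_nat x (\<lambda>_. Suc) y = x + y" for x y by (induction y) auto
  moreover have "computable n (\<lambda>xs. rec_nat (F xs) (\<lambda>i r. Suc r) (G xs))"
    by (intro computable_intros assms)
  ultimately show ?thesis by simp
qed

lemma computable_sum [computable_intros]:
  assumes "computable n B" "computable (Suc n) (\<lambda>ys. F (hd ys) (tl ys))"
  shows "computable n (\<lambda>xs. \<Sum>i<B xs. F i xs)"
proof -
  obtain f where f: "\<And>xs. length xs = Suc n \<Longrightarrow> evaluates f xs (F (hd xs) (tl xs))"
    using assms(2) unfolding computable_def by blast
  \<comment> \<open>In the recursion the step sees counter, partial sum and parameters; the
    projections skip the partial sum at index 1.\<close>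
  have "evaluates (Comp f (map Proj (0 # [2..<Suc (Suc n)]))) xs (F (hd xs) (tl (tl xs)))"
    if "length xs = Suc (Suc n)" for xs
    using that evaluates_projections[of 2 xs] f[of "hd xs # tl (tl xs)"]
    by (intro evaluates.Comp[where ys = "hd xs # tl (tl xs)"])
      (auto simp: drop_Suc numeral_2_eq_2 length_Suc_conv intro: evaluates.Proj[of 0 "_ # _", simplified])
  then have "computable (Suc (Suc n)) (\<lambda>ys. F (hd ys) (tl (tl ys)))"
    unfolding computable_def by blast
  then have "computable n (\<lambda>xs. rec_nat 0 (\<lambda>i r. r + F i xs) (B xs))"
    by (intro computable_intros assms)
  moreover have "rec_nat 0 (\<lambda>i r. r + g i) b = (\<Sum>i<b. g i)" for g :: "nat \<Rightarrow> nat" and b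
    by (induction b) auto
  ultimately show ?thesis by simp
qed

lemma computable_mult [computable_intros]:
  assumes "computable n F" "computable n G"
  shows "computable n (\<lambda>xs. F xs * G xs)"
proof -
  have "computable n (\<lambda>xs. \<Sum>i<F xs. G xs)"
    by (intro computable_intros assms computable_tl)
  then show ?thesis by simp
qed

lemma computable_power [computable_intros]:
  assumes "computable n F" "computable n G"
  shows "computable n (\<lambda>xs. F xs ^ G xs)"
proof -
  have "rec_nat 1 (\<lambda>_ r. r * x) y = x ^ y" for x y :: nat by (induction y) auto
  moreover have "computable n (\<lambda>xs. rec_nat 1 (\<lambda>i r. r * F xs) (G xs))"
    by (intro computable_intros assms computable_tl[OF computable_tl])
  ultimately show ?thesis by simp
qed

lemma computable_diff [computable_intros]:
  assumes "computable n F" "computable n G"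
  shows "computable n (\<lambda>xs. F xs - G xs)"
proof -
  have pred: "rec_nat 0 (\<lambda>i _. i) y = y - 1" for y :: nat by (cases y) auto
  have "rec_nat x (\<lambda>_ r. r - 1) y = x - y" for x y :: nat by (induction y) auto
  moreover have "computable n (\<lambda>xs. rec_nat (F xs) (\<lambda>_ r. rec_nat 0 (\<lambda>i _. i) r) (G xs))"
    by (intro computable_intros assms)
  ultimately show ?thesis by (simp add: pred)
qed

lemma decidable_less [computable_intros]:
  assumes "computable n F" "computable n G"
  shows "decidable n (\<lambda>xs. F xs < G xs)"
proof -
  have "of_bool (x < y) = 1 - (1 - (y - x))" for x y :: nat by auto
  then show ?thesis
    by (simp only:) (intro computable_intros assms)
qed

lemma decidable_not [computable_intros]:
  assumes "decidable n P"
  shows "decidable n (\<lambda>xs. \<not> P xs)"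
proof -
  have "of_bool (\<not> p) = 1 - (of_bool p :: nat)" for p by simp
  then show ?thesis
    by (simp only:) (intro computable_intros assms)
qed

lemma decidable_conj [computable_intros]:
  assumes "decidable n P" "decidable n Q"
  shows "decidable n (\<lambda>xs. P xs \<and> Q xs)"
  unfolding of_bool_conj by (intro computable_intros assms)

lemma decidable_eq [computable_intros]:
  assumes "computable n F" "computable n G"
  shows "decidable n (\<lambda>xs. F xs = G xs)"
  unfolding nat_neq_iff order.eq_iff not_less[symmetric] by (intro computable_intros assms)

lemma decidable_Bex [computable_intros]:
  assumes "computable n B" "decidable (Suc n) (\<lambda>ys. P (hd ys) (tl ys))"
  shows "decidable n (\<lambda>xs. \<exists>i<B xs. P i xs)"
proof -
  have "(\<exists>i<b. p i) \<longleftrightarrow> 0 < (\<Sum>i<b. of_bool (p i) :: nat)" for b :: nat and p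
    unfolding neq0_conv[symmetric] by (subst sum_eq_0_iff) auto
  then show ?thesis
    by (simp only:) (intro computable_intros assms)
qed

lemma computable_div [computable_intros]:
  assumes "computable n F" "computable n G"
  shows "computable n (\<lambda>xs. F xs div G xs)"
proof -
  \<comment> \<open>The quotient counts the positive multiples of \<open>y\<close> up to
    \<open>x\<close>. The first factor handles \<open>y = 0\<close>, where the count is
    \<open>x\<close> but division yields 0.\<close>
  have "x div y = of_bool (0 < y) * (\<Sum>i<x. of_bool (\<not> x < Suc i * y))" for x y :: nat
  proof (cases "y = 0")
    case False
    then have "{i. i < x \<and> \<not> x < Suc i * y} = {..<x div y}"
      by (auto simp: not_less less_eq_div_iff_mult_less_eq[symmetric] Suc_le_eq simp del: mult_Suc
        dest: order.strict_trans2[OF _ div_le_dividend])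
    then show ?thesis using False by (simp add: sum.If_cases of_bool_def Collect_conj_eq lessThan_def)
  qed auto
  then show ?thesis
    by (simp only:) (intro computable_intros assms computable_tl)
qed

lemma computable_mod [computable_intros]:
  assumes "computable n F" "computable n G"
  shows "computable n (\<lambda>xs. F xs mod G xs)"
  unfolding modulo_nat_def by (intro computable_intros assms)

section \<open>Pairing and list codes\<close>

lemma computable_prod_encode [computable_intros]:
  assumes "computable n F" "computable n G"
  shows "computable n (\<lambda>xs. prod_encode (F xs, G xs))"
  unfolding prod_encode_def triangle_def prod.case by (intro computable_intros assms)

text \<open>Decoding as bounded search: for \<open>c > 0\<close> exactly one pair passes the test,
  and both components are below \<open>c\<close>. For \<open>c = 0\<close>, the empty list, the
  value is the default 0.\<close>

definition code_hd :: "nat \<Rightarrow> nat" where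
  "code_hd c = (\<Sum>x<c. \<Sum>y<c. of_bool (c = Suc (prod_encode (x, y))) * x)"

definition code_tl :: "nat \<Rightarrow> nat" where
  "code_tl c = (\<Sum>x<c. \<Sum>y<c. of_bool (c = Suc (prod_encode (x, y))) * y)"

definition code_nth :: "nat \<Rightarrow> nat \<Rightarrow> nat" where
  "code_nth c i = code_hd (rec_nat c (\<lambda>_. code_tl) i)"

lemma sum_unique_pair:
  fixes h :: "nat \<Rightarrow> nat \<Rightarrow> nat"
  assumes "x < c" "y < c" "\<And>x' y'. P x' y' \<longleftrightarrow> x' = x \<and> y' = y"
  shows "(\<Sum>x'<c. \<Sum>y'<c. of_bool (P x' y') * h x' y') = h x y"
proof -
  have "(\<Sum>x'<c. \<Sum>y'<c. of_bool (P x' y') * h x' y') = (\<Sum>x'<c. if x' = x then h x y else 0)"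
    using assms(2) by (intro sum.cong refl) (auto simp: assms(3) of_bool_def if_distrib[of "\<lambda>b. b * _"] cong: if_cong)
  then show ?thesis using assms(1) by simp
qed

lemma code_hd_Cons: "code_hd (list_encode (x # xs)) = x"
  and code_tl_Cons: "code_tl (list_encode (x # xs)) = list_encode xs"
proof -
  let ?c = "list_encode (x # xs)"
  \<comment> \<open>The \<open>Suc\<close> in the list code makes these bounds strict, so the pair
    lies in the range of the search.\<close>
  have "x < ?c" "list_encode xs < ?c"
    using le_prod_encode_1[of x "list_encode xs"] le_prod_encode_2[of "list_encode xs" x] by auto
  moreover have "?c = Suc (prod_encode (x', y)) \<longleftrightarrow> x' = x \<and> y = list_encode xs" for x' y
    by auto
  ultimately show "code_hd ?c = x" "code_tl ?c = list_encode xs"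
    unfolding code_hd_def code_tl_def by (rule sum_unique_pair)+
qed

lemma code_nth_list_encode:
  assumes "i < length xs"
  shows "code_nth (list_encode xs) i = xs ! i"
proof -
  have "rec_nat (list_encode xs) (\<lambda>_. code_tl) j = list_encode (drop j xs)" if "j \<le> length xs" for j
    using that
  proof (induction j)
    case (Suc j)
    then have "drop j xs = xs ! j # drop (Suc j) xs" by (simp add: Cons_nth_drop_Suc)
    then show ?case using Suc by (simp add: code_tl_Cons del: list_encode.simps)
  qed simp
  moreover have "drop i xs = xs ! i # drop (Suc i) xs" using assms by (simp add: Cons_nth_drop_Suc)
  ultimately show ?thesis unfolding code_nth_def using assms
    by (simp add: code_hd_Cons del: list_encode.simps)
qed

lemma computable_code_hd [computable_intros]:
  "computable n F \<Longrightarrow> computable n (\<lambda>xs. code_hd (F xs))"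
  unfolding code_hd_def by (intro computable_intros computable_tl[of _ F] computable_tl[of _ "\<lambda>xs. F (tl xs)"])

lemma computable_code_tl [computable_intros]:
  "computable n F \<Longrightarrow> computable n (\<lambda>xs. code_tl (F xs))"
  unfolding code_tl_def by (intro computable_intros computable_tl[of _ F] computable_tl[of _ "\<lambda>xs. F (tl xs)"])

lemma computable_code_nth [computable_intros]:
  assumes "computable n F" "computable n G"
  shows "computable n (\<lambda>xs. code_nth (F xs) (G xs))"
proof -
  have "computable n (\<lambda>xs. code_hd (rec_nat (F xs) (\<lambda>i y. code_tl y) (G xs)))"
    by (intro computable_intros assms)
  then show ?thesis unfolding code_nth_def .
qed

text \<open>
  The word of length \<open>j\<close> is passed to the program as the number \<open>x\<close> whose last \<open>j\<close> digits it lists.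
\<close>

definition code_run :: "nat \<Rightarrow> nat \<Rightarrow> nat \<Rightarrow> nat \<Rightarrow> nat \<Rightarrow> nat" where
  "code_run k c q x j = rec_nat q (\<lambda>i p. code_nth c (2 + (p * k + x div k ^ i mod k))) j"

text \<open>The table of final states comes after the two leading entries and the transition table,
  whose size is the number of states times \<open>k\<close>.\<close>

definition code_final :: "nat \<Rightarrow> nat \<Rightarrow> nat \<Rightarrow> nat" where
  "code_final k c q = code_nth c (2 + (code_nth c 0 * k + q))"

text \<open>
  Words shorter than the number of (pairs of) states suffice to decide reachability and equivalence.
\<close>

definition code_reachable :: "nat \<Rightarrow> nat \<Rightarrow> nat \<Rightarrow> bool" where
  "code_reachable k c q \<longleftrightarrow> (\<exists>j<code_nth c 0. \<exists>x<k ^ code_nth c 0. code_run k c (code_nth c 1) x j = q)"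

definition code_distinct :: "nat \<Rightarrow> nat \<Rightarrow> nat \<Rightarrow> nat \<Rightarrow> bool" where
  "code_distinct k c p q \<longleftrightarrow> (\<exists>j<code_nth c 0 * code_nth c 0. \<exists>x<k ^ (code_nth c 0 * code_nth c 0).
     \<not> code_final k c (code_run k c p x j) = code_final k c (code_run k c q x j))"

text \<open>Classes of equivalent reachable states are counted by their least members; this is the
  size of the minimal automaton.\<close>

definition code_classes :: "nat \<Rightarrow> nat \<Rightarrow> nat" where
  "code_classes k c = (\<Sum>q<code_nth c 0. of_bool (code_reachable k c q \<and>
     \<not> (\<exists>p<q. code_reachable k c p \<and> \<not> code_distinct k c p q)))"

lemma computable_code_run [computable_intros]:
  assumes "computable n k" "computable n c" "computable n q" "computable n x" "computable n j"
  shows "computable n (\<lambda>xs. code_run (k xs) (c xs) (q xs) (x xs) (j xs))"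
  unfolding code_run_def
  by (intro computable_intros assms assms[THEN computable_tl, THEN computable_tl])

lemma computable_code_final [computable_intros]:
  assumes "computable n k" "computable n c" "computable n q"
  shows "computable n (\<lambda>xs. code_final (k xs) (c xs) (q xs))"
  unfolding code_final_def by (intro computable_intros assms)

lemma decidable_code_reachable [computable_intros]:
  assumes "computable n k" "computable n c" "computable n q"
  shows "decidable n (\<lambda>xs. code_reachable (k xs) (c xs) (q xs))"
  unfolding code_reachable_def
  by (intro computable_intros assms assms[THEN computable_tl]
      assms[THEN computable_tl, THEN computable_tl])

lemma decidable_code_distinct [computable_intros]:
  assumes "computable n k" "computable n c" "computable n p" "computable n q"
  shows "decidable n (\<lambda>xs. code_distinct (k xs) (c xs) (p xs) (q xs))"
  unfolding code_distinct_def
  by (intro computable_intros assms assms[THEN computable_tl]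
      assms[THEN computable_tl, THEN computable_tl])

lemma computable_code_classes [computable_intros]:
  assumes "computable n k" "computable n c"
  shows "computable n (\<lambda>xs. code_classes (k xs) (c xs))"
  unfolding code_classes_def
  by (intro computable_intros assms assms[THEN computable_tl]
      assms[THEN computable_tl, THEN computable_tl])

section \<open>Correctness of the computation\<close>

definition accepted_from :: "nat \<Rightarrow> dfa \<Rightarrow> nat \<Rightarrow> nat list set" where
  "accepted_from k A q = {w. set w \<subseteq> {..<k} \<and> foldl (delta A) q w \<in> final A}"

definition reachable :: "nat \<Rightarrow> dfa \<Rightarrow> nat set" where
  "reachable k A = foldl (delta A) (start A) ` {u. set u \<subseteq> {..<k}}"

lemma automaton_dfa: "is_dfa k A \<Longrightarrow> automaton {..<k} {..<nstates A} (delta A)"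
  unfolding is_dfa_def by unfold_locales auto

lemma reachable_subset:
  assumes "is_dfa k A"
  shows "reachable k A \<subseteq> {..<nstates A}"
proof -
  interpret automaton "{..<k}" "{..<nstates A}" "delta A" by (rule automaton_dfa[OF assms])
  show ?thesis
    using assms run_in_states unfolding reachable_def is_dfa_def by blast
qed

text \<open>The quotient by \<open>u\<close> is the language accepted from the state reached by
  \<open>u\<close>. This links a count made on \<open>A\<close> with a quantity of \<open>S\<close>
  alone.\<close>

lemma residuals_expansions:
  assumes "dfa_for k S A"
  shows "residuals {..<k} (expansions k S) = accepted_from k A ` reachable k A"
proof -
  have "expansions k S = language k A" using assms unfolding dfa_for_def by simp
  then have "foldl derivative (expansions k S) u = accepted_from k A (foldl (delta A) (start A) u)"
    if "set u \<subseteq> {..<k}" for u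
    using that unfolding foldl_derivative language_def accepted_from_def by simp
  then show ?thesis unfolding residuals_def reachable_def by (auto simp: image_image intro!: image_cong)
qed

lemma nth_concat_rows:
  assumes "q < n" "a < k"
  shows "length (concat (map (\<lambda>q. map (f q) [0..<k]) [0..<n])) = n * k"
    and "concat (map (\<lambda>q. map (f q) [0..<k]) [0..<n]) ! (q * k + a) = f q a"
proof -
  have len: "length (concat (map (\<lambda>q. map (f q) [0..<k]) [0..<n])) = n * k" for n
    by (induction n) auto
  then show "length (concat (map (\<lambda>q. map (f q) [0..<k]) [0..<n])) = n * k" .
  show "concat (map (\<lambda>q. map (f q) [0..<k]) [0..<n]) ! (q * k + a) = f q a"
    using assms(1)
  proof (induction n)
    case (Suc n)
    show ?case
    proof (cases "q = n")
      case True
      then show ?thesis using assms(2) by (simp add: nth_append len)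
    next
      case False
      then have "q < n" using Suc.prems by simp
      then have "Suc q * k \<le> n * k" by (intro mult_le_mono1) simp
      then have "q * k + a < n * k" using assms(2) by simp
      then show ?thesis using Suc.IH[OF \<open>q < n\<close>] by (simp add: nth_append len)
    qed
  qed simp
qed

lemma
  assumes A: "is_dfa k A" and c: "c = encode_dfa k A" and k: "0 < k"
  shows code_nstates: "code_nth c 0 = nstates A"
    and code_start: "code_nth c 1 = start A"
    and code_delta: "q < nstates A \<Longrightarrow> a < k \<Longrightarrow> code_nth c (2 + (q * k + a)) = delta A q a"
    and code_final: "q < nstates A \<Longrightarrow> code_final k c q = of_bool (q \<in> final A)"
proof -
  let ?rows = "concat (map (\<lambda>q. map (delta A q) [0..<k]) [0..<nstates A])"
  let ?xs = "nstates A # start A # ?rows @ map (\<lambda>q. of_bool (q \<in> final A)) [0..<nstates A]"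
  have c: "c = list_encode ?xs" unfolding c encode_dfa_def ..
  have n: "0 < nstates A" using A unfolding is_dfa_def by auto
  have len: "length ?rows = nstates A * k" by (rule nth_concat_rows(1)[OF n k])
  show nst: "code_nth c 0 = nstates A" unfolding c by (subst code_nth_list_encode) auto
  show "code_nth c 1 = start A" unfolding c by (subst code_nth_list_encode) auto
  show "code_nth c (2 + (q * k + a)) = delta A q a" if "q < nstates A" "a < k"
  proof -
    have "Suc q * k \<le> nstates A * k" using that by (intro mult_le_mono1) simp
    then have "q * k + a < nstates A * k" using that by simp
    then show ?thesis unfolding c using nth_concat_rows(2)[OF that, of "delta A"] len
      by (subst code_nth_list_encode) (auto simp: nth_append)
  qed
  show "code_final k c q = of_bool (q \<in> final A)" if "q < nstates A"
    unfolding code_final_def nst unfolding c using that len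
    by (subst code_nth_list_encode) (auto simp: nth_append)
qed

lemma code_run:
  assumes A: "is_dfa k A" and c: "c = encode_dfa k A" and k: "0 < k" and "q < nstates A"
  shows "code_run k c q x j = foldl (delta A) q (map (\<lambda>i. x div k ^ i mod k) [0..<j])"
proof -
  interpret automaton "{..<k}" "{..<nstates A}" "delta A" by (rule automaton_dfa[OF A])
  show ?thesis
  proof (induction j)
    case (Suc j)
    have "foldl (delta A) q (map (\<lambda>i. x div k ^ i mod k) [0..<j]) \<in> {..<nstates A}"
      using assms(4) k by (intro run_in_states) auto
    then show ?case
      using Suc code_delta[OF A c k] k unfolding code_run_def by simp
  qed (simp add: code_run_def)
qed

lemma digits_horner_sum:
  fixes k :: nat
  assumes "set w \<subseteq> {..<k}"
  shows "map (\<lambda>i. horner_sum id k w div k ^ i mod k) [0..<length w] = w"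
  using assms
proof (induction w)
  case (Cons a w)
  then have "a < k" by simp
  then have "(a + k * h) div (k * k ^ i) = h div k ^ i" for h i
    by (simp add: div_mult2_eq)
  then show ?case
    using Cons \<open>a < k\<close> by (simp add: map_upt_Suc id_def del: upt_Suc)
qed simp

text \<open>A word is the digit list of its own value, so a search over words becomes a bounded
  search over numbers. The length \<open>j\<close> is a separate variable because the value does not
  see zeros at the end of a word.\<close>

lemma ex_code_word:
  fixes k :: nat
  assumes "0 < k"
  shows "(\<exists>j<l. \<exists>x<k ^ l. P (map (\<lambda>i. x div k ^ i mod k) [0..<j])) \<longleftrightarrow>
    (\<exists>w. set w \<subseteq> {..<k} \<and> length w < l \<and> P w)"
proof safe
  fix j x assume "j < l" "P (map (\<lambda>i. x div k ^ i mod k) [0..<j])"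
  then show "\<exists>w. set w \<subseteq> {..<k} \<and> length w < l \<and> P w"
    using assms by (intro exI[of _ "map (\<lambda>i. x div k ^ i mod k) [0..<j]"]) auto
next
  fix w assume w: "set w \<subseteq> {..<k}" "length w < l" "P w"
  have "horner_sum id k w < k ^ length w" by (rule horner_sum_less[OF w(1)])
  also have "\<dots> \<le> k ^ l" using w(2) assms by (intro power_increasing) auto
  finally show "\<exists>j<l. \<exists>x<k ^ l. P (map (\<lambda>i. x div k ^ i mod k) [0..<j])"
    using w digits_horner_sum[OF w(1)] by metis
qed

lemma code_reachable_iff:
  assumes A: "is_dfa k A" and c: "c = encode_dfa k A" and k: "0 < k"
  shows "code_reachable k c q \<longleftrightarrow> q \<in> reachable k A"
proof -
  interpret automaton "{..<k}" "{..<nstates A}" "delta A" by (rule automaton_dfa[OF A])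
  have start: "start A < nstates A" using A unfolding is_dfa_def by simp
  have "code_reachable k c q \<longleftrightarrow>
      (\<exists>w. set w \<subseteq> {..<k} \<and> length w < nstates A \<and> foldl (delta A) (start A) w = q)"
    unfolding code_reachable_def code_nstates[OF A c k] code_start[OF A c k]
      code_run[OF A c k start] by (rule ex_code_word[OF k])
  also have "\<dots> \<longleftrightarrow> q \<in> reachable k A"
    unfolding reachable_def using short_word[of "start A"] start by (auto simp: image_iff) metis
  finally show ?thesis .
qed

lemma code_distinct_iff:
  assumes A: "is_dfa k A" and c: "c = encode_dfa k A" and k: "0 < k"
    and pq: "p < nstates A" "q < nstates A"
  shows "code_distinct k c p q \<longleftrightarrow> accepted_from k A p \<noteq> accepted_from k A q"
proof -
  interpret automaton "{..<k}" "{..<nstates A}" "delta A" by (rule automaton_dfa[OF A])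
  \<comment> \<open>The product automaton runs from \<open>p\<close> and \<open>q\<close> at once,
    so shortening a word there preserves both end states.\<close>
  let ?pair = "\<lambda>(p, q) a. (delta A p a, delta A q a)"
  interpret pairs: automaton "{..<k}" "{..<nstates A} \<times> {..<nstates A}" ?pair
    using step by unfold_locales auto
  have foldl_pair: "foldl ?pair (p, q) w = (foldl (delta A) p w, foldl (delta A) q w)" for p q w
    by (induction w arbitrary: p q) auto
  let ?sep = "\<lambda>w. (foldl (delta A) p w \<in> final A) \<noteq> (foldl (delta A) q w \<in> final A)"
  have fin: "code_final k c (foldl (delta A) r w) = of_bool (foldl (delta A) r w \<in> final A)"
    if "set w \<subseteq> {..<k}" "r < nstates A" for r w
    using that run_in_states[of r w] by (intro code_final[OF A c k]) auto
  have "code_distinct k c p q \<longleftrightarrow> (\<exists>w. set w \<subseteq> {..<k} \<and> length w < nstates A * nstates A \<and>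
      \<not> code_final k c (foldl (delta A) p w) = code_final k c (foldl (delta A) q w))"
    unfolding code_distinct_def code_nstates[OF A c k] code_run[OF A c k pq(1)]
      code_run[OF A c k pq(2)] by (rule ex_code_word[OF k])
  also have "\<dots> \<longleftrightarrow> (\<exists>w. set w \<subseteq> {..<k} \<and> length w < nstates A * nstates A \<and> ?sep w)"
    using fin pq by auto
  also have "\<dots> \<longleftrightarrow> (\<exists>w. set w \<subseteq> {..<k} \<and> ?sep w)"
  proof
    assume "\<exists>w. set w \<subseteq> {..<k} \<and> ?sep w"
    then obtain w where "set w \<subseteq> {..<k}" and sep: "?sep w" by blast
    then obtain w' where "set w' \<subseteq> {..<k}" "length w' < nstates A * nstates A"
      "foldl ?pair (p, q) w' = foldl ?pair (p, q) w"
      using pairs.short_word[of "(p, q)" w] pq by (auto simp: card_cartesian_product)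
    then show "\<exists>w. set w \<subseteq> {..<k} \<and> length w < nstates A * nstates A \<and> ?sep w"
      using sep unfolding foldl_pair by (intro exI[of _ w']) auto
  qed blast
  also have "\<dots> \<longleftrightarrow> accepted_from k A p \<noteq> accepted_from k A q"
    unfolding accepted_from_def by auto
  finally show ?thesis .
qed

text \<open>The least elements of the fibres of \<open>f\<close> on \<open>X\<close> form a system
  of representatives.\<close>

lemma card_image_least_representatives:
  fixes X :: "nat set"
  shows "card (f ` X) = card {q \<in> X. \<forall>p<q. p \<in> X \<longrightarrow> f p \<noteq> f q}" (is "_ = card ?R")
proof -
  have "inj_on f ?R"
  proof (rule inj_onI)
    fix p q assume "p \<in> ?R" "q \<in> ?R" "f p = f q"
    then show "p = q" by (cases p q rule: linorder_cases) auto
  qed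
  moreover have "f ` ?R = f ` X"
  proof
    show "f ` X \<subseteq> f ` ?R"
    proof (rule image_subsetI)
      fix x assume "x \<in> X"
      define q where "q = (LEAST q. q \<in> X \<and> f q = f x)"
      have "q \<in> X \<and> f q = f x" unfolding q_def by (rule LeastI[of _ x]) (use \<open>x \<in> X\<close> in simp)
      moreover have "\<not> (p \<in> X \<and> f p = f x)" if "p < q" for p
        using that unfolding q_def by (rule not_less_Least)
      ultimately have "q \<in> ?R" "f x = f q" by auto
      then show "f x \<in> f ` ?R" by blast
    qed
  qed blast
  ultimately show ?thesis using card_image[of f ?R] by simp
qed

text \<open>The right-hand side does not mention \<open>A\<close>: all automata for \<open>S\<close>
  yield the same number, as \<open>computed_by\<close> demands.\<close>

lemma code_classes_eq:
  assumes S: "dfa_for k S A" and k: "0 < k"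
  shows "code_classes k (encode_dfa k A) = card (residuals {..<k} (expansions k S))"
proof -
  define c where "c = encode_dfa k A"
  have A: "is_dfa k A" using S unfolding dfa_for_def by simp
  note reach = code_reachable_iff[OF A c_def k] and distinct = code_distinct_iff[OF A c_def k]
  have sub: "q < nstates A" if "q \<in> reachable k A" for q
    using reachable_subset[OF A] that by blast
  have count: "(\<Sum>q<n. of_bool (P q)) = card {q. q < n \<and> P q}" for n :: nat and P
    by (simp add: Collect_conj_eq lessThan_def)
  have "code_classes k c = card {q. q < nstates A \<and> code_reachable k c q \<and>
      \<not> (\<exists>p<q. code_reachable k c p \<and> \<not> code_distinct k c p q)}"
    unfolding code_classes_def code_nstates[OF A c_def k]
    by (rule count)
  also have "{q. q < nstates A \<and> code_reachable k c q \<and>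
      \<not> (\<exists>p<q. code_reachable k c p \<and> \<not> code_distinct k c p q)} =
      {q \<in> reachable k A. \<forall>p<q. p \<in> reachable k A \<longrightarrow> accepted_from k A p \<noteq> accepted_from k A q}"
    
  proof (rule Collect_cong)
    fix q
    have "code_distinct k c p q \<longleftrightarrow> accepted_from k A p \<noteq> accepted_from k A q"
      if "p \<in> reachable k A" "q \<in> reachable k A" for p
      using that sub distinct by blast
    then show "(q < nstates A \<and> code_reachable k c q \<and>
        \<not> (\<exists>p<q. code_reachable k c p \<and> \<not> code_distinct k c p q)) \<longleftrightarrow>
      (q \<in> reachable k A \<and>
        (\<forall>p<q. p \<in> reachable k A \<longrightarrow> accepted_from k A p \<noteq> accepted_from k A q))"
      unfolding reach using sub by blast
  qed
  also have "card \<dots> = card (residuals {..<k} (expansions k S))"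
    unfolding residuals_expansions[OF S] by (rule card_image_least_representatives[symmetric])
  finally show ?thesis unfolding c_def .
qed

theorem theorem4p1:
  "\<exists>f g :: recf. \<forall>(k::nat) (S::nat set).
     2 \<le> k \<longrightarrow> automatic k S \<longrightarrow> \<not> sparse S \<longrightarrow> Gcd S = 1 \<longrightarrow>
     (\<exists>N M :: nat.
        computed_by f k S N \<and> computed_by g k S M \<and>
        (\<forall>n\<ge>M. sum_of_at_most N S n) \<and>
        (\<forall>A. minimal_dfa_for k S A \<longrightarrow>
           N \<le> 5 * k ^ (16 * nstates A + 3) \<and> M \<le> 3 * k ^ (16 * nstates A + 5)))"
proof -
  \<comment> \<open>One scheme yields both programs. \<open>code_classes\<close> is a total
    function, so they halt for every \<open>c\<close>, code of an automaton or not.\<close>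
  have program: "\<exists>f. \<forall>k c. evaluates f [k, c] (a * k ^ (16 * code_classes k c + b))" for a b
  proof -
    have "computable 2 (\<lambda>xs. a * (xs ! 0) ^ (16 * code_classes (xs ! 0) (xs ! 1) + b))"
      by (intro computable_intros) simp_all
    then obtain f where "\<And>xs. length xs = 2 \<Longrightarrow>
        evaluates f xs (a * (xs ! 0) ^ (16 * code_classes (xs ! 0) (xs ! 1) + b))"
      unfolding computable_def by blast
    from this[of "[_, _]"] show ?thesis by auto
  qed
  obtain f g where f: "\<And>k c. evaluates f [k, c] (5 * k ^ (16 * code_classes k c + 3))"
    and g: "\<And>k c. evaluates g [k, c] (3 * k ^ (16 * code_classes k c + 5))"
    using program[of 5 3] program[of 3 5] by blast
  show ?thesis
  proof (intro exI allI impI conjI)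
    fix k :: nat and S :: "nat set"
    assume k: "2 \<le> k" and S: "automatic k S" "\<not> sparse S" "Gcd S = 1"
    define m where "m = card (residuals {..<k} (expansions k S))"
    have code: "code_classes k (encode_dfa k A) = m" if "dfa_for k S A" for A
      using code_classes_eq[OF that] k unfolding m_def by simp
    show "computed_by f k S (5 * k ^ (16 * m + 3))" "computed_by g k S (3 * k ^ (16 * m + 5))"
      unfolding computed_by_def using f g code by metis+
    \<comment> \<open>Distinct left quotients come from distinct reachable states, so
      \<open>m\<close> is at most the number of states of any automaton for
      \<open>S\<close>.\<close>
    have m_le: "finite (residuals {..<k} (expansions k S)) \<and> m \<le> nstates A" if "dfa_for k S A" for A
    proof -
      have "reachable k A \<subseteq> {..<nstates A}"
        using that reachable_subset unfolding dfa_for_def by blast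
      then have "finite (reachable k A)" "card (reachable k A) \<le> nstates A"
        using finite_subset card_mono[of "{..<nstates A}"] by auto
      then show ?thesis
        unfolding m_def residuals_expansions[OF that] by (meson card_image_le finite_imageI order_trans)
    qed
    obtain A where "dfa_for k S A" using S(1) unfolding automatic_def by blast
    then have fin: "finite (residuals {..<k} (expansions k S))" using m_le by blast
    show "sum_of_at_most (5 * k ^ (16 * m + 3)) S n" if "3 * k ^ (16 * m + 5) \<le> n" for n
      by (rule sum_of_at_most_residuals[OF k fin S(2,3) m_def that])
    show "5 * k ^ (16 * m + 3) \<le> 5 * k ^ (16 * nstates A + 3)"
      "3 * k ^ (16 * m + 5) \<le> 3 * k ^ (16 * nstates A + 5)" if "minimal_dfa_for k S A" for A
      using that m_le[of A] k unfolding minimal_dfa_for_def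
      by (auto intro!: mult_le_mono2 power_increasing)
  qed
qed

end
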